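(* For every integer $n \ge 2$, we have $$60(n^2-n+1)\, r_{L_1}(n) - r_{E_8}(2n) \begin{cases} =0 & \text{if } n \text{ is prime with } n \equiv 1 \pmod{4},\\ < 0 & \text{if } n \not\equiv 1 \pmod{4},\\ >0 & \text{otherwise,}\end{cases}$$ and $$60(n^2-n+1)\, r_{L_2}(n) - r_{E_8}(2n) \begin{cases} =0 & \text{if } n \text{ is prime with } n \equiv 3 \pmod{4},\\ < 0 & \text{if } n \not\equiv 3 \pmod{4},\\ >0 & \text{otherwise.}\end{cases}$$
   Context: The (translated) lattices $L_1, L_2 \subset \mathbb{R}^4$ and $E_8 \subset \mathbb{R}^8$ are $$L_1 := \mathbb{Z}\begin{pmatrix}2\\0\\0\\0\end{pmatrix} + \mathbb{Z}\begin{pmatrix}0\\2\\0\\0\end{pmatrix} + \mathbb{Z}\begin{pmatrix}0\\0\\\sqrt2\\0\end{pmatrix} + \mathbb{Z}\begin{pmatrix}0\\0\\0\\\sqrt2\end{pmatrix} + \frac{1}{\sqrt2}\begin{pmatrix}0\\0\\1\\1\end{pmatrix},$$ $$L_2 := \mathbb{Z}\begin{pmatrix}2\\0\\0\\0\end{pmatrix} + \mathbb{Z}\begin{pmatrix}0\\2\\0\\0\end{pmatrix} + \mathbb{Z}\begin{pmatrix}0\\0\\\sqrt2\\0\end{pmatrix} + \mathbb{Z}\begin{pmatrix}0\\0\\0\\\sqrt2\end{pmatrix} + \frac{1}{\sqrt2}\begin{pmatrix}\sqrt2\\\sqrt2\\1\\1\end{pmatrix},$$ and, with $e_1,\dots,e_8$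 the standard basis of $\mathbb{R}^8$, $$E_8 := \mathbb{Z}\,(2e_1) + \sum_{i=1}^{6} \mathbb{Z}\,(e_{i+1} - e_i) + \mathbb{Z}\cdot\tfrac12 (e_1 + e_2 + \cdots + e_8).$$ For $L \in \{L_1, L_2, E_8\}$, define $r_L(n) := \#\{x \in L : \|x\|^2 = n\}$, where $\|(x_1,\dots,x_r)\|^2 = x_1^2 + \cdots + x_r^2$. *)

theory Defs
  imports "HOL-Analysis.Analysis" "HOL-Number_Theory.Number_Theory"
begin

definition L1 :: "(real ^ 4) set" where
  "L1 = {of_int a *\<^sub>R vector [2, 0, 0, 0] + of_int b *\<^sub>R vector [0, 2, 0, 0]
       + of_int c *\<^sub>R vector [0, 0, sqrt 2, 0] + of_int d *\<^sub>R vector [0, 0, 0, sqrt 2]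
       + (1 / sqrt 2) *\<^sub>R vector [0, 0, 1, 1] | a b c d :: int. True}"

definition L2 :: "(real ^ 4) set" where
  "L2 = {of_int a *\<^sub>R vector [2, 0, 0, 0] + of_int b *\<^sub>R vector [0, 2, 0, 0]
       + of_int c *\<^sub>R vector [0, 0, sqrt 2, 0] + of_int d *\<^sub>R vector [0, 0, 0, sqrt 2]
       + (1 / sqrt 2) *\<^sub>R vector [sqrt 2, sqrt 2, 1, 1] | a b c d :: int. True}"

text \<open>The standard basis of $R^8$ is indexed by the naturals 1, ..., 8. In the index type
  the numerals 8 and 0 coincide, so these are eight distinct indices.\<close>

definition e :: "nat \<Rightarrow> real ^ 8" where
  "e i = axis (of_nat i) 1"

definition E8 :: "(real ^ 8) set" where
  "E8 = {of_int a *\<^sub>R (2 *\<^sub>R e 1)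
       + (\<Sum>i = 1..6. of_int (b i) *\<^sub>R (e (i + 1) - e i))
       + of_int c *\<^sub>R ((1 / 2) *\<^sub>R (\<Sum>i = 1..8. e i)) | (a :: int) (b :: nat \<Rightarrow> int) (c :: int). True}"

text \<open>The number of vectors of squared Euclidean norm \<open>n\<close>. For the discrete sets
  above the counted set is finite, so \<open>card\<close> is its true cardinality.\<close>

definition r :: "(real ^ 'n) set \<Rightarrow> int \<Rightarrow> nat" where
  "r L n = card {x \<in> L. (norm x)\<^sup>2 = of_int n}"

end

theory Submission imports Defs begin

text \<open>
  The statement follows from exact formulas for both sides. Write $\sigma_k(n)$ for the sum of the \<open>k\<close>-th powers of
  the positive divisors of \<open>n\<close> (\<open>divisor_power_sum\<close>).

  The numbers $r_{L_1}(n)$ and $r_{L_2}(n)$ are $4\sigma_1(n)$ for $n \equiv 1$, respectively $n \equiv 3$, modulo 4 and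
  zero otherwise (\<open>r_L1\<close>, \<open>r_L2\<close>), and $r_{E_8}(2n) = 240\,\sigma_3(n)$ for odd \<open>n\<close> (\<open>r_E8_odd\<close>). Hence for \<open>n\<close> in
  the right residue class the difference is 240 times
  \[ (n^2 - n + 1)\,\sigma_1(n) - \sigma_3(n) = \sum_{d \mid n} d\,(n^2 - n + 1 - d^2). \]
  The terms for \<open>d = 1\<close> and \<open>d = n\<close> cancel and all others are positive, so the difference is zero for primes and positive
  for composite numbers. For all other \<open>n\<close> it is negative because $E_8$ has vectors of every norm \<open>2 * n\<close>.

  The formulas are proved by elementary means, without modular forms. After a rotation, $r_{L_i}(n)$ counts representations of \<open>n\<close> by
  four squares with prescribed parities; in the right residue class these are half of all representations, whose number is $8\sigma_1(n)$ by Jacobi's theorem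
  (\<open>card_four_squares\<close>). By a Hadamard matrix that theorem reduces to sums of four odd squares, whose number satisfies a recurrence
  by the symmetry of sums of five odd squares (\<open>four_odd_squares_recurrence\<close>). That $\sigma_1$ satisfies the same
  recurrence amounts to the vanishing of a sum over indefinite binary quadratic forms, which
  an involution shows (\<open>form_sum_zero\<close>).

  For $E_8$, the half-integral vectors and the integral vectors whose first four entries have an odd sum are counted by the convolution of
  $\sigma_1$ with itself over odd arguments. A substitution of Dirichlet and Liouville evaluates it as
  $\sigma_3$ (\<open>divisor_sum_convolution\<close>). All integral vectors are reached
  by averaging over seven ways to split the eight positions into two halves (\<open>seven_splittings\<close>).
\<close>

section \<open>Divisor sums and sums of four squares\<close>

definition divisor_power_sum :: "nat \<Rightarrow> int \<Rightarrow> int" where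
  "divisor_power_sum k n = (\<Sum>d | 0 < d \<and> d dvd n. d ^ k)"

definition four_squares :: "int \<Rightarrow> (int \<times> int \<times> int \<times> int) set" where
  "four_squares n = {(a, b, c, d). a\<^sup>2 + b\<^sup>2 + c\<^sup>2 + d\<^sup>2 = n}"

definition four_odd_squares :: "int \<Rightarrow> (int \<times> int \<times> int \<times> int) set" where
  "four_odd_squares n = {(a, b, c, d) \<in> four_squares n. odd a \<and> odd b \<and> odd c \<and> odd d}"

lemma square_bound: "x\<^sup>2 \<le> n \<Longrightarrow> x \<in> {-n..n}" for x n :: int
proof -
  assume "x\<^sup>2 \<le> n"
  moreover have "\<bar>x\<bar> \<le> x\<^sup>2"
  proof (cases "x = 0")
    case False
    then have "\<bar>x\<bar> * 1 \<le> \<bar>x\<bar> * \<bar>x\<bar>" by (intro mult_left_mono) auto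
    then show ?thesis by (simp add: power2_eq_square)
  qed simp
  ultimately show ?thesis by auto
qed

lemma finite_four_squares [simp]: "finite (four_squares n)"
proof -
  have "four_squares n \<subseteq> {-n..n} \<times> {-n..n} \<times> {-n..n} \<times> {-n..n}"
    unfolding four_squares_def
    by (clarify, intro conjI SigmaI square_bound) (smt (verit) zero_le_power2)+
  then show ?thesis by (rule finite_subset) simp
qed

lemma finite_four_odd_squares [simp]: "finite (four_odd_squares n)"
  by (rule finite_subset[OF _ finite_four_squares[of n]]) (auto simp: four_odd_squares_def)

lemma odd_square_mod_8: "odd k \<Longrightarrow> k\<^sup>2 mod 8 = 1" for k :: int
proof -
  assume "odd k"
  then obtain m where m: "k = 2 * m + 1" by (auto elim: oddE)
  have "even (m * (m + 1))" by auto
  then obtain j where "m * (m + 1) = 2 * j" by (rule evenE)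
  then have "k\<^sup>2 = 1 + 8 * j" using m by (simp add: power2_eq_square algebra_simps)
  then show ?thesis by simp
qed

lemma even_square_mod_4: "even k \<Longrightarrow> k\<^sup>2 mod 4 = 0" for k :: int
  by (auto elim!: evenE simp: power2_eq_square)

section \<open>A sum over indefinite binary quadratic forms\<close>

text \<open>The triple $(k, a, b)$ stands for the binary quadratic form $a x^2 + k x y - b y^2$ of
  discriminant $k^2 + 4ab$ that is positive at $(1, 0)$ and negative at $(0, 1)$.\<close>

definition forms :: "int \<Rightarrow> (int \<times> int \<times> int) set" where
  "forms M = {(k, a, b). 0 < a \<and> 0 < b \<and> k\<^sup>2 + 4 * a * b = M}"

lemma finite_forms: "finite (forms M)"
proof -
  have "forms M \<subseteq> {-M..M} \<times> {0..M} \<times> {0..M}"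
  proof
    fix q assume "q \<in> forms M"
    obtain k a b where q: "q = (k, a, b)" by (cases q) auto
    with \<open>q \<in> forms M\<close> have *: "0 < a" "0 < b" "k\<^sup>2 + 4 * (a * b) = M" by (auto simp: forms_def)
    have "a * 1 \<le> a * b" "1 * b \<le> a * b" using * by (auto intro: mult_left_mono mult_right_mono)
    moreover have "k \<in> {-M..M}"
      by (rule square_bound) (use * in \<open>smt (verit) mult_pos_pos\<close>)
    moreover have "0 \<le> k\<^sup>2" by simp
    ultimately show "q \<in> {-M..M} \<times> {0..M} \<times> {0..M}"
      using * unfolding q by (intro SigmaI) (unfold atLeastAtMost_iff, linarith+)
  qed
  then show ?thesis by (rule finite_subset) simp
qed

text \<open>Swapping \<open>a\<close> with \<open>b\<close> and adding the sum of $k(a^2 - b^2)$, which vanishes because it is odd in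
  \<open>k\<close>, turns twice the sum into the sum of $G = (a + b)(a + k)(b - k)$. Split the forms by the sign of
  their value $a + k - b$ at $(1, 1)$; this value is odd, hence nonzero, because \<open>M mod 8 = 5\<close> makes \<open>k\<close>, \<open>a\<close> and
  \<open>b\<close> odd. The symmetry $(k, a, b) \mapsto (-k, b, a)$ preserves \<open>G\<close> and exchanges the two halves.
  On the positive half the unimodular substitution $(k, a, b) \mapsto (2b - k, a + k - b, b)$ is an
  involution that permutes the factors of \<open>G\<close> up to one sign. So each half contributes zero.\<close>

lemma form_sum_zero:
  assumes "M mod 8 = 5"
  shows "(\<Sum>(k, a, b) \<in> forms M. a * (a * b - k\<^sup>2)) = 0"
proof -
  let ?S = "forms M"
  define G :: "int \<times> int \<times> int \<Rightarrow> int" where "G = (\<lambda>(k, a, b). (a + b) * (a + k) * (b - k))"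
  define P where "P = {(k, a, b) \<in> ?S. b < a + k}"
  define Q where "Q = {(k, a, b) \<in> ?S. a + k < b}"
  have odd: "odd k \<and> odd a \<and> odd b" if "(k, a, b) \<in> ?S" for k a b
  proof -
    have M: "k\<^sup>2 + 4 * (a * b) = M" using that by (auto simp: forms_def)
    have "odd k"
    proof
      assume "even k" then have "even (k\<^sup>2 + 4 * (a * b))" by simp
      with M assms show False by presburger
    qed
    then have "k\<^sup>2 mod 8 = 1" by (rule odd_square_mod_8)
    have "odd (a * b)"
    proof
      assume "even (a * b)"
      then obtain j where "a * b = 2 * j" by (rule evenE)
      then have "M = k\<^sup>2 + 8 * j" using M by simp
      with \<open>k\<^sup>2 mod 8 = 1\<close> assms show False by presburger
    qed
    with \<open>odd k\<close> show ?thesis by auto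
  qed
  have split: "?S = P \<union> Q" "P \<inter> Q = {}"
  proof -
    have "a + k \<noteq> b" if "(k, a, b) \<in> ?S" for k a b
      using odd[OF that] by auto
    then show "?S = P \<union> Q" unfolding P_def Q_def by fastforce
    show "P \<inter> Q = {}" unfolding P_def Q_def by auto
  qed
  have fin: "finite P" "finite Q"
    unfolding P_def Q_def by (rule finite_subset[OF _ finite_forms[of M]], blast)+
  have "(\<Sum>q \<in> Q. G q) = (\<Sum>q \<in> P. G q)"
    by (rule sum.reindex_bij_witness[of _ "\<lambda>(k, a, b). (- k, b, a)" "\<lambda>(k, a, b). (- k, b, a)"])
       (auto simp: P_def Q_def forms_def G_def algebra_simps)
  moreover have "(\<Sum>q \<in> P. G q) = (\<Sum>q \<in> P. - G q)"
    by (rule sum.reindex_bij_witness[of _ "\<lambda>(k, a, b). (2 * b - k, a + k - b, b)"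
          "\<lambda>(k, a, b). (2 * b - k, a + k - b, b)"])
       (auto simp: P_def forms_def G_def algebra_simps power2_eq_square)
  moreover have "(\<Sum>q \<in> ?S. G q) = (\<Sum>q \<in> P. G q) + (\<Sum>q \<in> Q. G q)"
    unfolding split(1) using fin split(2) by (rule sum.union_disjoint)
  ultimately have "(\<Sum>q \<in> ?S. G q) = 0"
    unfolding sum_negf by linarith
  moreover have "(\<Sum>q \<in> ?S. G q) = (\<Sum>(k, a, b) \<in> ?S. a * (a * b - k\<^sup>2)) + (\<Sum>(k, a, b) \<in> ?S. b * (a * b - k\<^sup>2))
      - (\<Sum>(k, a, b) \<in> ?S. k * (a\<^sup>2 - b\<^sup>2))"
    unfolding sum.distrib[symmetric] sum_subtractf[symmetric]
    by (rule sum.cong) (auto simp: G_def algebra_simps power2_eq_square)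
  moreover have "(\<Sum>(k, a, b) \<in> ?S. b * (a * b - k\<^sup>2)) = (\<Sum>(k, a, b) \<in> ?S. a * (a * b - k\<^sup>2))"
    by (rule sum.reindex_bij_witness[of _ "\<lambda>(k, a, b). (k, b, a)" "\<lambda>(k, a, b). (k, b, a)"])
       (auto simp: forms_def algebra_simps)
  moreover have "(\<Sum>(k, a, b) \<in> ?S. k * (a\<^sup>2 - b\<^sup>2)) = (\<Sum>(k, a, b) \<in> ?S. - (k * (a\<^sup>2 - b\<^sup>2)))"
    by (rule sum.reindex_bij_witness[of _ "\<lambda>(k, a, b). (- k, a, b)" "\<lambda>(k, a, b). (- k, a, b)"])
       (auto simp: forms_def)
  then have "(\<Sum>(k, a, b) \<in> ?S. k * (a\<^sup>2 - b\<^sup>2)) = 0"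
    by (simp add: sum_negf case_prod_unfold)
  ultimately show ?thesis by simp
qed

lemma finite_divisors: "n \<noteq> 0 \<Longrightarrow> finite {d :: int. 0 < d \<and> d dvd n}"
  by (rule finite_subset[of _ "{0..\<bar>n\<bar>}"]) (auto dest: dvd_imp_le_int)

definition odd_roots_below :: "int \<Rightarrow> int set" where
  "odd_roots_below M = {k. odd k \<and> k\<^sup>2 < M}"

lemma finite_odd_roots_below [simp]: "finite (odd_roots_below M)"
  by (rule finite_subset[of _ "{-M..M}"]) (use square_bound in \<open>force simp: odd_roots_below_def\<close>)+

text \<open>The vanishing sum over forms, with the forms grouped by their middle coefficient: for fixed \<open>k\<close>
  the coefficient \<open>a\<close> runs through the divisors of $(M - k^2)/4$, and $M - 5k^2 = 4(ab - k^2)$.\<close>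

lemma divisor_sum_recurrence:
  assumes M: "M mod 8 = 5"
  shows "(\<Sum>k \<in> odd_roots_below M. (M - 5 * k\<^sup>2) * divisor_power_sum 1 ((M - k\<^sup>2) div 4)) = 0"
proof -
  let ?D = "\<lambda>k. {d. 0 < d \<and> d dvd (M - k\<^sup>2) div 4}"
  have dv: "4 * ((M - k\<^sup>2) div 4) = M - k\<^sup>2" "0 < (M - k\<^sup>2) div 4" if "k \<in> odd_roots_below M" for k
  proof -
    have "k\<^sup>2 mod 8 = 1" "k\<^sup>2 < M" using that odd_square_mod_8 by (auto simp: odd_roots_below_def)
    then show "4 * ((M - k\<^sup>2) div 4) = M - k\<^sup>2" "0 < (M - k\<^sup>2) div 4" using M by presburger+
  qed
  have "(\<Sum>k \<in> odd_roots_below M. (M - 5 * k\<^sup>2) * divisor_power_sum 1 ((M - k\<^sup>2) div 4))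
      = (\<Sum>k \<in> odd_roots_below M. \<Sum>d \<in> ?D k. (M - 5 * k\<^sup>2) * d)"
    by (simp add: divisor_power_sum_def sum_distrib_left)
  also have "\<dots> = (\<Sum>(k, d) \<in> Sigma (odd_roots_below M) ?D. (M - 5 * k\<^sup>2) * d)"
    by (rule sum.Sigma) (use dv(2) in \<open>force intro!: finite_divisors\<close>)+
  also have "\<dots> = (\<Sum>(k, a, b) \<in> forms M. 4 * (a * (a * b - k\<^sup>2)))"
  proof (rule sum.reindex_bij_witness[of _ "\<lambda>(k, a, b). (k, a)" "\<lambda>(k, a). (k, a, ((M - k\<^sup>2) div 4) div a)"], goal_cases)
    case (1 x)
    then show ?case using dv by (auto simp: )
  next
    case (2 x)
    obtain k a where x: "x = (k, a)" by force
    with 2 have k: "k \<in> odd_roots_below M" and a: "0 < a" "a dvd (M - k\<^sup>2) div 4" by auto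
    let ?b = "((M - k\<^sup>2) div 4) div a"
    have ab: "a * ?b = (M - k\<^sup>2) div 4" using a by simp
    with dv[OF k] have "0 < a * ?b" "4 * (a * ?b) = M - k\<^sup>2" by simp_all
    moreover have "0 < ?b" using \<open>0 < a * ?b\<close> a(1) by (rule zero_less_mult_pos)
    ultimately show ?case using a(1) unfolding x forms_def
      by (simp only: mem_Collect_eq prod.case mult.assoc) simp
  next
    case (3 q)
    obtain k a b where q: "q = (k, a, b)" by (cases q) auto
    with 3 have *: "0 < a" "0 < b" "k\<^sup>2 + 4 * a * b = M" by (auto simp: forms_def)
    then show ?case unfolding q by auto
  next
    case (4 q)
    obtain k a b where q: "q = (k, a, b)" by (cases q) auto
    with 4 have *: "0 < a" "0 < b" "M = k\<^sup>2 + 4 * (a * b)" by (auto simp: forms_def)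
    have "odd k"
    proof
      assume "even k" then have "even M" using * by simp
      with M show False by presburger
    qed
    moreover have "0 < a * b" using * by simp
    ultimately show ?case using * unfolding q by (auto simp: odd_roots_below_def)
  next
    case (5 x)
    obtain k a where x: "x = (k, a)" by force
    with 5 have k: "k \<in> odd_roots_below M" and a: "0 < a" "a dvd (M - k\<^sup>2) div 4" by auto
    define b where "b = ((M - k\<^sup>2) div 4) div a"
    have "a * b = (M - k\<^sup>2) div 4" using a by (simp add: b_def)
    with dv[OF k] have "4 * (a * b) = M - k\<^sup>2" by simp
    then have "M = k\<^sup>2 + 4 * (a * b)" by linarith
    then have "M - 5 * k\<^sup>2 = 4 * (a * b - k\<^sup>2)" by (simp add: algebra_simps)
    then have "4 * (a * (a * b - k\<^sup>2)) = (M - 5 * k\<^sup>2) * a" by (simp only: ac_simps)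
    then show ?case unfolding x b_def by simp
  qed
  also have "\<dots> = 4 * (\<Sum>(k, a, b) \<in> forms M. a * (a * b - k\<^sup>2))"
    by (simp add: sum_distrib_left case_prod_unfold)
  finally show ?thesis using form_sum_zero[OF M] by simp
qed

section \<open>Sums of four odd squares and Jacobi's theorem\<close>

lemma card_four_odd_squares_4: "card (four_odd_squares 4) = 16"
proof -
  have "four_odd_squares 4 = {1, -1} \<times> {1, -1} \<times> {1, -1} \<times> {1, -1 :: int}"
  proof
    show "four_odd_squares 4 \<subseteq> {1, -1} \<times> {1, -1} \<times> {1, -1} \<times> {1, -1 :: int}"
    proof
      fix q assume q: "q \<in> four_odd_squares 4"
      obtain a b c d where abcd: "q = (a, b, c, d)" by (cases q) auto
      have ge: "1 \<le> x\<^sup>2" if "odd x" for x :: int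
        using that by (cases "x = 0") (auto simp: int_one_le_iff_zero_less)
      have one: "x = 1 \<or> x = -1" if "x\<^sup>2 = 1" for x :: int
        using that by (simp add: power2_eq_1_iff)
      have "a\<^sup>2 + b\<^sup>2 + c\<^sup>2 + d\<^sup>2 = 4" "odd a" "odd b" "odd c" "odd d"
        using q unfolding abcd by (auto simp: four_odd_squares_def four_squares_def)
      then have "a\<^sup>2 = 1 \<and> b\<^sup>2 = 1 \<and> c\<^sup>2 = 1 \<and> d\<^sup>2 = 1"
        using ge[of a] ge[of b] ge[of c] ge[of d] by linarith
      then show "q \<in> {1, -1} \<times> {1, -1} \<times> {1, -1} \<times> {1, -1}"
        unfolding abcd using one by blast
    qed
  qed (auto simp: four_odd_squares_def four_squares_def)
  then show ?thesis by (simp add: card_cartesian_product)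
qed

text \<open>In a sum of five odd squares equal to \<open>M\<close> all five positions are equivalent, so the average of
  any one square is $M/5$. In terms of generating functions this is
  $\theta \, (\theta^4)' = 4 \, \theta' \, \theta^4$.\<close>

lemma four_odd_squares_recurrence:
  "(\<Sum>k \<in> odd_roots_below M. (M - 5 * k\<^sup>2) * int (card (four_odd_squares (M - k\<^sup>2)))) = 0"
proof -
  define V where "V = Sigma (odd_roots_below M) (\<lambda>k. four_odd_squares (M - k\<^sup>2))"
  have V: "(k, a, b, c, d) \<in> V \<longleftrightarrow> odd k \<and> odd a \<and> odd b \<and> odd c \<and> odd d \<and>
      k\<^sup>2 + a\<^sup>2 + b\<^sup>2 + c\<^sup>2 + d\<^sup>2 = M" for k a b c d
  proof -
    have "0 < a\<^sup>2 + b\<^sup>2 + c\<^sup>2 + d\<^sup>2" if "odd a" using that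
      by (smt (verit) zero_le_power2 zero_less_power2 odd_even_add dvd_0_right)
    then show ?thesis unfolding V_def
      by (auto simp: odd_roots_below_def four_odd_squares_def four_squares_def)
  qed
  let ?s = "\<Sum>(k, a, b, c, d) \<in> V. k\<^sup>2"
  have 1: "(\<Sum>(k, a, b, c, d) \<in> V. a\<^sup>2) = ?s"
    by (rule sum.reindex_bij_witness[of _ "\<lambda>(k, a, b, c, d). (a, k, b, c, d)" "\<lambda>(k, a, b, c, d). (a, k, b, c, d)"])
       (auto simp: V algebra_simps)
  have 2: "(\<Sum>(k, a, b, c, d) \<in> V. b\<^sup>2) = ?s"
    by (rule sum.reindex_bij_witness[of _ "\<lambda>(k, a, b, c, d). (b, a, k, c, d)" "\<lambda>(k, a, b, c, d). (b, a, k, c, d)"])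
       (auto simp: V algebra_simps)
  have 3: "(\<Sum>(k, a, b, c, d) \<in> V. c\<^sup>2) = ?s"
    by (rule sum.reindex_bij_witness[of _ "\<lambda>(k, a, b, c, d). (c, a, b, k, d)" "\<lambda>(k, a, b, c, d). (c, a, b, k, d)"])
       (auto simp: V algebra_simps)
  have 4: "(\<Sum>(k, a, b, c, d) \<in> V. d\<^sup>2) = ?s"
    by (rule sum.reindex_bij_witness[of _ "\<lambda>(k, a, b, c, d). (d, a, b, c, k)" "\<lambda>(k, a, b, c, d). (d, a, b, c, k)"])
       (auto simp: V algebra_simps)
  have "(\<Sum>k \<in> odd_roots_below M. (M - 5 * k\<^sup>2) * int (card (four_odd_squares (M - k\<^sup>2))))
      = (\<Sum>(k, q) \<in> V. M - 5 * k\<^sup>2)"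
    unfolding V_def by (subst sum.Sigma[symmetric]) (auto simp: algebra_simps)
  also have "\<dots> = (\<Sum>(k, a, b, c, d) \<in> V. k\<^sup>2 + a\<^sup>2 + b\<^sup>2 + c\<^sup>2 + d\<^sup>2 - 5 * k\<^sup>2)"
    by (rule sum.cong) (auto simp: V)
  also have "\<dots> = 0"
    using 1 2 3 4 by (simp add: case_prod_unfold sum.distrib sum_subtractf flip: sum_distrib_left)
  finally show ?thesis .
qed

text \<open>The number of representations and the divisor sum satisfy the same recurrence, with $M = 4n + 1$.
  Its terms $k = \pm 1$ carry the value at \<open>n\<close> with the factor $4n - 4$, all other terms carry
  values at smaller odd numbers. The factor vanishes only for \<open>n = 1\<close>, where the count is direct.\<close>

lemma card_four_odd_squares:
  assumes "0 < n" "odd n"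
  shows "int (card (four_odd_squares (4 * n))) = 16 * divisor_power_sum 1 n"
  using assms
proof (induction "nat n" arbitrary: n rule: less_induct)
  case less
  show ?case
  proof (cases "n = 1")
    case True
    have "{d. 0 < d \<and> d dvd (1::int)} = {1}" by auto
    then show ?thesis using True card_four_odd_squares_4 by (simp add: divisor_power_sum_def)
  next
    case False
    define M where "M = 4 * n + 1"
    have M: "M mod 8 = 5" using \<open>odd n\<close> unfolding M_def by presburger
    define f where "f k = int (card (four_odd_squares (M - k\<^sup>2))) - 16 * divisor_power_sum 1 ((M - k\<^sup>2) div 4)" for k
    let ?K = "odd_roots_below M"
    have "(\<Sum>k \<in> ?K. (M - 5 * k\<^sup>2) * f k) = 0"
    proof -
      have "(\<Sum>k \<in> ?K. (M - 5 * k\<^sup>2) * f k)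
          = (\<Sum>k \<in> ?K. (M - 5 * k\<^sup>2) * int (card (four_odd_squares (M - k\<^sup>2))))
            - 16 * (\<Sum>k \<in> ?K. (M - 5 * k\<^sup>2) * divisor_power_sum 1 ((M - k\<^sup>2) div 4))"
        unfolding f_def sum_distrib_left sum_subtractf[symmetric]
        by (rule sum.cong) (auto simp: algebra_simps)
      then show ?thesis using four_odd_squares_recurrence[of M] divisor_sum_recurrence[OF M] by simp
    qed
    moreover have "(\<Sum>k \<in> ?K. (M - 5 * k\<^sup>2) * f k) = (\<Sum>k \<in> {1, -1}. (M - 5 * k\<^sup>2) * f k)"
    proof (rule sum.mono_neutral_right)
      show "{1, -1} \<subseteq> ?K" using less.prems by (auto simp: odd_roots_below_def M_def)
      show "\<forall>k \<in> ?K - {1, -1}. (M - 5 * k\<^sup>2) * f k = 0"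
      proof
        fix k assume k: "k \<in> ?K - {1, -1}"
        then have "odd k" and kM: "k\<^sup>2 < M" and k1: "k\<^sup>2 \<noteq> 1"
          by (auto simp: odd_roots_below_def power2_eq_1_iff)
        (* Replacing 1 by the larger square 8 * m + 1 lowers the argument from n to n - 2 * m. *)
        define m where "m = k\<^sup>2 div 8"
        have m: "k\<^sup>2 = 8 * m + 1"
          using odd_square_mod_8[OF \<open>odd k\<close>] unfolding m_def by (metis mult_div_mod_eq)
        have "0 \<le> k\<^sup>2" by simp
        then have "0 < m" using k1 unfolding m by presburger
        define n' where "n' = n - 2 * m"
        have "0 < n'" "n' < n" "odd n'" "M - k\<^sup>2 = 4 * n'"
          using m \<open>0 < m\<close> kM less.prems unfolding n'_def M_def by auto
        with less.hyps[of n'] show "(M - 5 * k\<^sup>2) * f k = 0" by (simp add: f_def)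
      qed
    qed simp
    moreover have "f (-1) = f 1" by (simp add: f_def)
    ultimately have "(\<Sum>k \<in> {1, -1}. (M - 5 * k\<^sup>2) * f k) = 0" "f (-1) = f 1" by simp_all
    then have "M = 5 \<or> f 1 = 0" by auto
    with False have "f 1 = 0" by (simp add: M_def)
    then show ?thesis by (simp add: f_def M_def)
  qed
qed

text \<open>Jacobi's four square theorem for odd \<open>n\<close>. The matrix of the map \<open>?h\<close> is a Hadamard matrix, so \<open>?h\<close>
  multiplies the sum of squares by 4. It sends vectors of odd norm \<open>n\<close> to vectors with four odd entries, and
  its image consists of those whose sum is divisible by 4. Changing the sign of the first entry
  shows that these are one half of all odd vectors of norm \<open>4 * n\<close>.\<close>

theorem card_four_squares:
  assumes "0 < n" "odd n"
  shows "int (card (four_squares n)) = 8 * divisor_power_sum 1 n"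
proof -
  define P where "P = {(a, b, c, d) \<in> four_odd_squares (4 * n). 4 dvd a + b + c + d}"
  define Q where "Q = {(a, b, c, d) \<in> four_odd_squares (4 * n). \<not> 4 dvd a + b + c + d}"
  have fin: "finite P" "finite Q"
    unfolding P_def Q_def by (rule finite_subset[OF _ finite_four_odd_squares[of "4 * n"]], blast)+
  have "four_odd_squares (4 * n) = P \<union> Q" "P \<inter> Q = {}" by (auto simp: P_def Q_def)
  then have "card (four_odd_squares (4 * n)) = card P + card Q"
    using fin by (simp add: card_Un_disjoint)
  moreover have "card P = card Q"
  proof (rule bij_betw_same_card, rule bij_betw_byWitness[where f' = "\<lambda>(a, b, c, d). (- a, b, c, d)"])
    have *: "4 dvd a + b + c + d \<longleftrightarrow> \<not> 4 dvd b - a + c + d"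
      if "odd a" "odd b" "odd c" "odd d" for a b c d :: int
      using that by presburger
    show "(\<lambda>(a, b, c, d). (- a, b, c, d)) ` P \<subseteq> Q" "(\<lambda>(a, b, c, d). (- a, b, c, d)) ` Q \<subseteq> P"
      using * by (auto simp: P_def Q_def four_odd_squares_def four_squares_def)
  qed auto
  moreover have "card (four_squares n) = card P"
  proof -
    let ?h = "\<lambda>(a, b, c, d). (a + b + c + d, a + b - c - d, a - b + c - d, a - b - c + d :: int)"
    let ?g = "\<lambda>(a, b, c, d). ((a + b + c + d) div 4, (a + b - c - d) div 4, (a - b + c - d) div 4, (a - b - c + d) div 4 :: int)"
    show ?thesis
    proof (rule bij_betw_same_card[of ?h], rule bij_betw_byWitness[where f' = ?g])
      show "\<forall>q \<in> four_squares n. ?g (?h q) = q" by auto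
      have *: "4 dvd a + b + c + d" "4 dvd a + b - c - d" "4 dvd a - b + c - d" "4 dvd a - b - c + d"
        if "odd a" "odd b" "odd c" "odd d" "4 dvd a + b + c + d" for a b c d :: int
        using that by presburger+
      have P: "\<exists>x y z w. a = x + y + z + w \<and> b = x + y - z - w \<and> c = x - y + z - w \<and> d = x - y - z + w \<and>
          ?g (a, b, c, d) = (x, y, z, w) \<and> x\<^sup>2 + y\<^sup>2 + z\<^sup>2 + w\<^sup>2 = n" if "(a, b, c, d) \<in> P" for a b c d
      proof -
        have o: "odd a" "odd b" "odd c" "odd d" "4 dvd a + b + c + d" and
          s: "a\<^sup>2 + b\<^sup>2 + c\<^sup>2 + d\<^sup>2 = 4 * n"
          using that by (auto simp: P_def four_odd_squares_def four_squares_def)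
        obtain x y z w where x: "a + b + c + d = 4 * x" "a + b - c - d = 4 * y" "a - b + c - d = 4 * z" "a - b - c + d = 4 * w"
          using *[OF o] unfolding dvd_def by blast
        then have e: "a = x + y + z + w" "b = x + y - z - w" "c = x - y + z - w" "d = x - y - z + w"
          by linarith+
        have "x\<^sup>2 + y\<^sup>2 + z\<^sup>2 + w\<^sup>2 = n"
          using s unfolding e by (simp add: power2_eq_square algebra_simps)
        with e show ?thesis by auto
      qed
      show "\<forall>q \<in> P. ?h (?g q) = q"
        using P by fastforce
      show "?g ` P \<subseteq> four_squares n"
        using P by (fastforce simp: four_squares_def)
      show "?h ` four_squares n \<subseteq> P"
      proof
        fix q assume "q \<in> ?h ` four_squares n"
        then obtain a b c d where abcd: "a\<^sup>2 + b\<^sup>2 + c\<^sup>2 + d\<^sup>2 = n" "q = ?h (a, b, c, d)"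
          by (auto simp: four_squares_def)
        then have "odd (a\<^sup>2 + b\<^sup>2 + c\<^sup>2 + d\<^sup>2)" using \<open>odd n\<close> by simp
        then have o: "odd (a + b + c + d)" by simp
        have "(a + b + c + d)\<^sup>2 + (a + b - c - d)\<^sup>2 + (a - b + c - d)\<^sup>2 + (a - b - c + d)\<^sup>2 = 4 * n"
          unfolding abcd(1)[symmetric] by (simp add: power2_eq_square algebra_simps)
        with o show "q \<in> P" unfolding abcd(2) P_def four_odd_squares_def four_squares_def by simp
      qed
    qed
  qed
  ultimately show ?thesis using card_four_odd_squares[OF assms] by simp
qed

section \<open>A convolution of divisor sums\<close>

definition odd_solutions :: "int \<Rightarrow> (int \<times> int \<times> int \<times> int) set" where
  "odd_solutions N = {(a, x, b, y). odd a \<and> odd x \<and> odd b \<and> odd y \<and>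
     0 < a \<and> 0 < x \<and> 0 < b \<and> 0 < y \<and> a * x + b * y = N}"

lemma finite_odd_solutions [simp]: "finite (odd_solutions N)"
proof -
  have "odd_solutions N \<subseteq> {0..N} \<times> {0..N} \<times> {0..N} \<times> {0..N}"
  proof
    fix q assume q: "q \<in> odd_solutions N"
    obtain a x b y where abxy: "q = (a, x, b, y)" by (cases q) auto
    have pos: "0 < a" "0 < x" "0 < b" "0 < y" and eq: "a * x + b * y = N"
      using q unfolding abxy odd_solutions_def by auto
    have "a * 1 \<le> a * x" "1 * x \<le> a * x" "b * 1 \<le> b * y" "1 * y \<le> b * y"
      by (intro mult_left_mono mult_right_mono; use pos in simp)+
    then show "q \<in> {0..N} \<times> {0..N} \<times> {0..N} \<times> {0..N}"
      using pos eq unfolding abxy by (intro SigmaI) (unfold atLeastAtMost_iff, linarith+)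
  qed
  then show ?thesis by (rule finite_subset) simp
qed

lemma convolution_eq_odd_solutions:
  "(\<Sum>i | odd i \<and> 0 < i \<and> i < 2 * n. divisor_power_sum 1 i * divisor_power_sum 1 (2 * n - i))
   = (\<Sum>(a, x, b, y) \<in> odd_solutions (2 * n). a * b)"
proof -
  let ?I = "{i :: int. odd i \<and> 0 < i \<and> i < 2 * n}"
  let ?D = "\<lambda>i :: int. {d. 0 < d \<and> d dvd i}"
  have finI: "finite ?I" by (rule finite_subset[of _ "{0..2 * n}"]) auto
  have "(\<Sum>i \<in> ?I. divisor_power_sum 1 i * divisor_power_sum 1 (2 * n - i))
      = (\<Sum>i \<in> ?I. \<Sum>(a, b) \<in> ?D i \<times> ?D (2 * n - i). a * b)"
    by (simp add: divisor_power_sum_def sum_product sum.cartesian_product)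
  also have "\<dots> = (\<Sum>(i, a, b) \<in> Sigma ?I (\<lambda>i. ?D i \<times> ?D (2 * n - i)). a * b)"
    by (rule sum.Sigma[OF finI]) (auto intro!: finite_divisors finite_cartesian_product)
  also have "\<dots> = (\<Sum>(a, x, b, y) \<in> odd_solutions (2 * n). a * b)"
  proof (rule sum.reindex_bij_witness[of _ "\<lambda>(a, x, b, y). (a * x, a, b)"
          "\<lambda>(i, a, b). (a, i div a, b, (2 * n - i) div b)"], goal_cases)
    case (2 p)
    then obtain i a b where p: "p = (i, a, b)" and *: "odd i" "0 < i" "i < 2 * n" "0 < a" "0 < b"
      "a dvd i" "b dvd 2 * n - i" by (cases p) auto
    from \<open>a dvd i\<close> obtain x where x: "i = a * x" ..
    from \<open>b dvd 2 * n - i\<close> obtain y where y: "2 * n - i = b * y" ..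
    have "odd (b * y)" using \<open>odd i\<close> unfolding y[symmetric] by simp
    moreover have "0 < b * y" "0 < a * x" using * unfolding x[symmetric] y[symmetric] by simp_all
    moreover have "i div a = x" "(2 * n - i) div b = y" using * x y by simp_all
    ultimately show ?case unfolding p odd_solutions_def using * x y
      by (simp add: zero_less_mult_iff)
  next
    case (3 q)
    then obtain a x b y where q: "q = (a, x, b, y)" and "0 < a" "0 < b" and eq: "2 * n - a * x = b * y"
      by (cases q) (auto simp: odd_solutions_def)
    then show ?case unfolding q by simp
  next
    case (4 q)
    then obtain a x b y where q: "q = (a, x, b, y)" and *: "odd a" "odd x" "odd b" "odd y"
      "0 < a" "0 < x" "0 < b" "0 < y" and eq: "2 * n - a * x = b * y"
      by (cases q) (auto simp: odd_solutions_def)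
    have "0 < a * x" "0 < b * y" using * by simp_all
    moreover have "a * x < 2 * n" using \<open>0 < b * y\<close> unfolding eq[symmetric] by simp
    ultimately show ?case unfolding q using * eq by simp
  qed (auto simp: odd_solutions_def)
  finally show ?thesis .
qed

text \<open>A substitution of Dirichlet and Liouville. With \<open>b < a\<close> put $D = a - b$, $S = x + y$ and
  divide $b = r + Dq$; the equation becomes $Dx + Sr + DSq = N$ with $0 < r < D$ and $0 < x < S$.
  A solution with \<open>y < x\<close> leads to the same equation for $D = a + b$, $S = x - y$, $r = a$,
  by dividing \<open>y\<close> by \<open>S\<close>. So both kinds of solutions are parametrised by the same set \<open>Z\<close>, and the parameter \<open>D\<close>
  is $a - b$ for the one and $a + b$ for the other.\<close>

lemma sum_odd_solutions_descent:
  "(\<Sum>(a, x, b, y) | (a, x, b, y) \<in> odd_solutions N \<and> b < a. f (a - b))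
   = (\<Sum>(a, x, b, y) | (a, x, b, y) \<in> odd_solutions N \<and> y < x. f (a + b))"
  (is "sum ?f ?P = sum ?g ?Q")
proof -
  define F :: "int \<times> int \<times> int \<times> int \<Rightarrow> int \<times> int \<times> int \<times> int" where
    "F = (\<lambda>(a, x, b, y). (b mod (a - b), x + (x + y) * (b div (a - b) + 1),
            (a - b) - b mod (a - b), x + (x + y) * (b div (a - b))))"
  define G :: "int \<times> int \<times> int \<times> int \<Rightarrow> int \<times> int \<times> int \<times> int" where
    "G = (\<lambda>(a, x, b, y). (a + (a + b) * (y div (x - y) + 1), y mod (x - y),
            a + (a + b) * (y div (x - y)), (x - y) - y mod (x - y)))"
  have F: "F (r + D * q + D, x, r + D * q, S - x) = (r, x + S * (q + 1), D - r, x + S * q)"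
    if "0 < r" "r < D" for r D q x S
    using that by (simp add: F_def)
  have G: "G (r, x + S * (q + 1), D - r, x + S * q) = (r + D * q + D, x, r + D * q, S - x)"
    if "0 < x" "x < S" for r D q x S
  proof -
    have "x + S * (q + 1) - (x + S * q) = S" by (simp add: algebra_simps)
    then show ?thesis using that by (simp add: G_def) (simp add: algebra_simps)
  qed
  (* In Z, D is the even difference a - b or sum a + b, and S the even sum x + y or difference x - y. *)
  define Z where "Z = {(r, D, q, x, S). odd r \<and> even D \<and> odd x \<and> even S \<and> 0 < r \<and> r < D \<and> 0 < x \<and> x < S \<and> (0::int) \<le> q
     \<and> D * x + S * (r + D * q) = N}"
  have P: "\<exists>r D q x S. (r, D, q, x, S) \<in> Z \<and> t = (r + D * q + D, x, r + D * q, S - x)" if "t \<in> ?P" for t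
  proof -
    obtain a x b y where t: "t = (a, x, b, y)" by (cases t) auto
    have *: "odd a" "odd x" "odd b" "odd y" "0 < x" "0 < b" "0 < y" "b < a" "a * x + b * y = N"
      using that unfolding t odd_solutions_def by auto
    define D r q where "D = a - b" and "r = b mod D" and "q = b div D"
    have b: "b = r + D * q" by (simp add: r_def q_def)
    have D: "even D" "0 < D" using * by (auto simp: D_def)
    then have "odd r" using b \<open>odd b\<close> by simp
    moreover have "0 \<le> r" "r < D" "0 \<le> q" using D * by (auto simp: r_def q_def pos_imp_zdiv_nonneg_iff)
    moreover from \<open>odd r\<close> \<open>0 \<le> r\<close> have "0 < r" by (cases "r = 0") auto
    moreover have "D * x + (x + y) * b = N" using * by (simp add: D_def algebra_simps)
    ultimately have "(r, D, q, x, x + y) \<in> Z" using D * by (simp add: Z_def b)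
    moreover have "t = (r + D * q + D, x, r + D * q, (x + y) - x)"
      unfolding t b[symmetric] by (simp add: D_def)
    ultimately show ?thesis by blast
  qed
  have Q: "\<exists>r D q x S. (r, D, q, x, S) \<in> Z \<and> t = (r, x + S * (q + 1), D - r, x + S * q)" if "t \<in> ?Q" for t
  proof -
    obtain a x b y where t: "t = (a, x, b, y)" by (cases t) auto
    have *: "odd a" "odd x" "odd b" "odd y" "0 < a" "0 < b" "0 < y" "y < x" "a * x + b * y = N"
      using that unfolding t odd_solutions_def by auto
    define S r q where "S = x - y" and "r = y mod S" and "q = y div S"
    have y: "y = r + S * q" by (simp add: r_def q_def)
    have S: "even S" "0 < S" using * by (auto simp: S_def)
    then have "odd r" using y \<open>odd y\<close> by simp
    moreover have "0 \<le> r" "r < S" "0 \<le> q" using S * by (auto simp: r_def q_def pos_imp_zdiv_nonneg_iff)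
    moreover from \<open>odd r\<close> \<open>0 \<le> r\<close> have "0 < r" by (cases "r = 0") auto
    moreover have "(a + b) * y + S * a = N" using * by (simp add: S_def algebra_simps)
    then have "(a + b) * r + S * (a + (a + b) * q) = N" unfolding y by (simp add: algebra_simps)
    ultimately have "(a, a + b, q, r, S) \<in> Z" using S * by (simp add: Z_def)
    moreover have "t = (a, r + S * (q + 1), (a + b) - a, r + S * q)"
      unfolding t using y by (simp add: S_def algebra_simps)
    ultimately show ?thesis by blast
  qed
  have Zpos: "0 < r + D * q" "0 < x + S * q" if "(r, D, q, x, S) \<in> Z" for r D q x S
    using that by (auto simp: Z_def intro!: add_pos_nonneg mult_nonneg_nonneg)
  have P': "(r + D * q + D, x, r + D * q, S - x) \<in> ?P" if "(r, D, q, x, S) \<in> Z" for r D q x S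
    using Zpos[OF that] that by (auto simp: Z_def odd_solutions_def algebra_simps)
  have Q': "(r, x + S * (q + 1), D - r, x + S * q) \<in> ?Q" if "(r, D, q, x, S) \<in> Z" for r D q x S
    using Zpos[OF that] that by (auto simp: Z_def odd_solutions_def algebra_simps)
  show ?thesis
  proof (rule sum.reindex_bij_witness[of _ G F])
    fix t assume "t \<in> ?P"
    then obtain r D q x S where Z: "(r, D, q, x, S) \<in> Z" and t: "t = (r + D * q + D, x, r + D * q, S - x)"
      using P by blast
    have b: "0 < r" "r < D" "0 < x" "x < S" using Z by (auto simp: Z_def)
    show "G (F t) = t" unfolding t F[OF b(1,2)] G[OF b(3,4)] ..
    show "F t \<in> ?Q" unfolding t F[OF b(1,2)] by (rule Q'[OF Z])
    show "?g (F t) = ?f t" unfolding t F[OF b(1,2)] by simp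
  next
    fix t assume "t \<in> ?Q"
    then obtain r D q x S where Z: "(r, D, q, x, S) \<in> Z" and t: "t = (r, x + S * (q + 1), D - r, x + S * q)"
      using Q by blast
    have b: "0 < r" "r < D" "0 < x" "x < S" using Z by (auto simp: Z_def)
    show "F (G t) = t" unfolding t G[OF b(3,4)] F[OF b(1,2)] ..
    show "G t \<in> ?P" unfolding t G[OF b(3,4)] by (rule P'[OF Z])
  qed
qed

lemma card_odd_below: "0 \<le> d \<Longrightarrow> int (card {a :: int. odd a \<and> 0 < a \<and> a < 2 * d}) = d"
proof -
  assume "0 \<le> d"
  have "bij_betw (\<lambda>j. 2 * j + 1) {0..<d} {a :: int. odd a \<and> 0 < a \<and> a < 2 * d}"
    by (rule bij_betw_byWitness[where f' = "\<lambda>a. a div 2"]) (auto elim!: oddE)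
  then show ?thesis using \<open>0 \<le> d\<close> by (simp add: bij_betw_same_card[symmetric])
qed

text \<open>If \<open>x = y\<close>, then $a + b = 2d$ with \<open>d\<close> a divisor of \<open>n\<close> and $x = n/d$, and \<open>a\<close> is any of the \<open>d\<close>
  odd numbers below $2d$. The oddness of \<open>n\<close> makes every $n/d$ odd.\<close>

lemma sum_odd_solutions_diagonal:
  assumes "0 < n" "odd n"
  shows "(\<Sum>(a, x, b, y) | (a, x, b, y) \<in> odd_solutions (2 * n) \<and> x = y. (a + b)\<^sup>2) = 4 * divisor_power_sum 3 n"
proof -
  let ?D = "{d. 0 < d \<and> d dvd n}" and ?O = "\<lambda>d. {a :: int. odd a \<and> 0 < a \<and> a < 2 * d}"
  have finD: "finite ?D" using assms by (simp add: finite_divisors)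
  have "(\<Sum>(a, x, b, y) | (a, x, b, y) \<in> odd_solutions (2 * n) \<and> x = y. (a + b)\<^sup>2)
      = (\<Sum>(d, a) \<in> Sigma ?D ?O. (2 * d)\<^sup>2)"
  proof (rule sum.reindex_bij_witness[of _ "\<lambda>(d, a). (a, n div d, 2 * d - a, n div d)"
        "\<lambda>(a, x, b, y). ((a + b) div 2, a)"], goal_cases)
    case (1 t)
    then obtain a b x where t: "t = (a, x, b, x)" and *: "odd a" "odd b" "0 < x" "(a + b) * x = 2 * n"
      by (auto simp: odd_solutions_def algebra_simps)
    then have "even (a + b)" by simp
    then obtain d where d: "a + b = 2 * d" by (rule evenE)
    with * have "d * x = n" by simp
    then show ?case using d \<open>0 < x\<close> assms unfolding t by auto
  next
    case (2 t)
    then obtain a b x where t: "t = (a, x, b, x)" and *: "odd a" "odd b" "0 < x" "0 < a" "0 < b" "(a + b) * x = 2 * n"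
      by (auto simp: odd_solutions_def algebra_simps)
    then have "even (a + b)" by simp
    then obtain d where d: "a + b = 2 * d" by (rule evenE)
    with * have "n = d * x" by simp
    then show ?case using d * unfolding t by auto
  next
    case (3 p)
    then show ?case by (auto)
  next
    case (4 p)
    then obtain d a k where "p = (d, a)" "n = d * k" "0 < d" "odd a" "0 < a" "a < 2 * d"
      by (auto elim!: dvdE)
    then show ?case using assms by (auto simp: odd_solutions_def zero_less_mult_iff algebra_simps)
  next
    case (5 t)
    then obtain a b x where t: "t = (a, x, b, x)" and "odd a" "odd b"
      by (auto simp: odd_solutions_def)
    then have "even (a + b)" by simp
    then obtain d where "a + b = 2 * d" by (rule evenE)
    then show ?case unfolding t by simp
  qed
  also have "\<dots> = (\<Sum>d \<in> ?D. \<Sum>a \<in> ?O d. (2 * d)\<^sup>2)"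
    by (rule sum.Sigma[symmetric, OF finD]) (auto intro: finite_subset[of _ "{0..2 * d}" for d])
  also have "\<dots> = (\<Sum>d \<in> ?D. 4 * d ^ 3)"
    by (rule sum.cong) (auto simp: card_odd_below power2_eq_square power3_eq_cube)
  finally show ?thesis by (simp add: divisor_power_sum_def sum_distrib_left)
qed

text \<open>Write $4ab = (a + b)^2 - (a - b)^2$. By the substitution above, the terms
  with \<open>a \<noteq> b\<close> of the sum of $(a - b)^2$ cancel those with \<open>x \<noteq> y\<close> of the sum of $(a + b)^2$. The terms with
  \<open>a = b\<close> are zero, so that the diagonal \<open>x = y\<close> remains.\<close>

theorem divisor_sum_convolution:
  assumes "0 < n" "odd n"
  shows "(\<Sum>i | odd i \<and> 0 < i \<and> i < 2 * n. divisor_power_sum 1 i * divisor_power_sum 1 (2 * n - i))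
    = divisor_power_sum 3 n"
proof -
  let ?W = "odd_solutions (2 * n)"
  define sq_diff sq_sum :: "int \<times> int \<times> int \<times> int \<Rightarrow> int" where
    "sq_diff = (\<lambda>(a, x, b, y). (a - b)\<^sup>2)" and "sq_sum = (\<lambda>(a, x, b, y). (a + b)\<^sup>2)"
  define A1 A2 A3 where "A1 = {(a, x, b, y). (a, x, b, y) \<in> ?W \<and> b < a}"
    and "A2 = {(a, x, b, y). (a, x, b, y) \<in> ?W \<and> a < b}" and "A3 = {(a, x, b, y). (a, x, b, y) \<in> ?W \<and> a = b}"
  define X1 X2 X3 where "X1 = {(a, x, b, y). (a, x, b, y) \<in> ?W \<and> y < x}"
    and "X2 = {(a, x, b, y). (a, x, b, y) \<in> ?W \<and> x < y}" and "X3 = {(a, x, b, y). (a, x, b, y) \<in> ?W \<and> x = y}"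
  have fin: "finite A1" "finite A2" "finite A3" "finite X1" "finite X2" "finite X3"
    unfolding A1_def A2_def A3_def X1_def X2_def X3_def
    by (rule finite_subset[OF _ finite_odd_solutions[of "2 * n"]], blast)+
  have "sum sq_diff ?W = sum sq_diff A1 + sum sq_diff A2 + sum sq_diff A3"
  proof -
    have "?W = (A1 \<union> A2) \<union> A3" by (auto simp: A1_def A2_def A3_def)
    moreover have "A1 \<inter> A2 = {}" "(A1 \<union> A2) \<inter> A3 = {}" by (auto simp: A1_def A2_def A3_def)
    ultimately show ?thesis using fin by (simp add: sum.union_disjoint)
  qed
  moreover have "sum sq_diff A3 = 0"
    by (rule sum.neutral) (auto simp: A3_def sq_diff_def)
  moreover have "sum sq_diff A2 = sum sq_diff A1"
    by (rule sum.reindex_bij_witness[of _ "\<lambda>(a, x, b, y). (b, y, a, x)" "\<lambda>(a, x, b, y). (b, y, a, x)"])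
       (auto simp: A1_def A2_def sq_diff_def odd_solutions_def power2_commute)
  moreover have "sum sq_sum ?W = sum sq_sum X1 + sum sq_sum X2 + sum sq_sum X3"
  proof -
    have "?W = (X1 \<union> X2) \<union> X3" by (auto simp: X1_def X2_def X3_def)
    moreover have "X1 \<inter> X2 = {}" "(X1 \<union> X2) \<inter> X3 = {}" by (auto simp: X1_def X2_def X3_def)
    ultimately show ?thesis using fin by (simp add: sum.union_disjoint)
  qed
  moreover have "sum sq_sum X2 = sum sq_sum X1"
    by (rule sum.reindex_bij_witness[of _ "\<lambda>(a, x, b, y). (b, y, a, x)" "\<lambda>(a, x, b, y). (b, y, a, x)"])
       (auto simp: X1_def X2_def sq_sum_def odd_solutions_def add.commute)
  moreover have "sum sq_sum X3 = 4 * divisor_power_sum 3 n"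
    using sum_odd_solutions_diagonal[OF assms] by (simp add: X3_def sq_sum_def)
  moreover have "sum sq_diff A1 = sum sq_sum X1"
    using sum_odd_solutions_descent[where f = "\<lambda>t. t\<^sup>2"] by (simp add: A1_def X1_def sq_diff_def sq_sum_def)
  moreover have "4 * (\<Sum>(a, x, b, y) \<in> ?W. a * b) = sum sq_sum ?W - sum sq_diff ?W"
    unfolding sum_distrib_left sum_subtractf[symmetric]
    by (rule sum.cong) (auto simp: sq_sum_def sq_diff_def power2_eq_square algebra_simps)
  ultimately have "(\<Sum>(a, x, b, y) \<in> ?W. a * b) = divisor_power_sum 3 n" by linarith
  then show ?thesis by (simp only: convolution_eq_odd_solutions)
qed

section \<open>Sums of eight squares\<close>

lemma square_mod_4: "x\<^sup>2 mod 4 = of_bool (odd x)" for x :: int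
proof (cases "odd x")
  case True
  then have "x\<^sup>2 mod 8 = 1" by (rule odd_square_mod_8)
  then have "x\<^sup>2 mod 4 = 1" by presburger
  with True show ?thesis by simp
qed (simp add: even_square_mod_4)

lemma card_convolution:
  fixes P Q :: "int \<Rightarrow> 'a set" and N :: int
  assumes "\<And>i. finite (P i)" "\<And>i. finite (Q i)"
    and "\<And>p i j. p \<in> P i \<Longrightarrow> p \<in> P j \<Longrightarrow> i = j"
  shows "int (card {(p, q). \<exists>i. odd i \<and> 0 < i \<and> i < N \<and> p \<in> P i \<and> q \<in> Q i})
    = (\<Sum>i | odd i \<and> 0 < i \<and> i < N. int (card (P i)) * int (card (Q i)))"
proof -
  let ?I = "{i. odd i \<and> 0 < i \<and> i < N}"
  have fin: "finite ?I" by (rule finite_subset[of _ "{0..N}"]) auto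
  have "{(p, q). \<exists>i. odd i \<and> 0 < i \<and> i < N \<and> p \<in> P i \<and> q \<in> Q i} = (\<Union>i \<in> ?I. P i \<times> Q i)" by auto
  moreover have "card (\<Union>i \<in> ?I. P i \<times> Q i) = (\<Sum>i \<in> ?I. card (P i \<times> Q i))"
  proof (rule card_UN_disjoint[OF fin])
    show "\<forall>i \<in> ?I. finite (P i \<times> Q i)" by (simp add: assms)
    show "\<forall>i \<in> ?I. \<forall>j \<in> ?I. i \<noteq> j \<longrightarrow> P i \<times> Q i \<inter> (P j \<times> Q j) = {}"
      using assms(3) by blast
  qed
  ultimately show ?thesis by (simp add: card_cartesian_product)
qed

lemma four_squares_unique: "p \<in> four_squares i \<Longrightarrow> p \<in> four_squares j \<Longrightarrow> i = j"
  by (auto simp: four_squares_def)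

lemma four_odd_squares_unique: "p \<in> four_odd_squares i \<Longrightarrow> p \<in> four_odd_squares j \<Longrightarrow> i = j"
  by (auto simp: four_odd_squares_def four_squares_def)

type_synonym int8 = "(int \<times> int \<times> int \<times> int) \<times> (int \<times> int \<times> int \<times> int)"

definition eight_squares :: "int \<Rightarrow> int8 set" where
  "eight_squares N = {((a, b, c, d), (w, x, y, z)).
     a\<^sup>2 + b\<^sup>2 + c\<^sup>2 + d\<^sup>2 + w\<^sup>2 + x\<^sup>2 + y\<^sup>2 + z\<^sup>2 = N}"

definition eight_odd_squares :: "int \<Rightarrow> int8 set" where
  "eight_odd_squares N = {((a, b, c, d), (w, x, y, z)) \<in> eight_squares N.
     odd a \<and> odd b \<and> odd c \<and> odd d \<and> odd w \<and> odd x \<and> odd y \<and> odd z}"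

fun odd_first_half :: "int8 \<Rightarrow> bool" where
  "odd_first_half ((a, b, c, d), q) = odd (a + b + c + d)"

lemma finite_eight_squares [simp]: "finite (eight_squares N)"
proof -
  let ?B = "{-N..N} \<times> {-N..N} \<times> {-N..N} \<times> {-N..N}"
  have "eight_squares N \<subseteq> ?B \<times> ?B"
  proof
    fix t assume t: "t \<in> eight_squares N"
    obtain a b c d w x y z where abc: "t = ((a, b, c, d), (w, x, y, z))" by (metis prod.exhaust)
    have eq: "a\<^sup>2 + b\<^sup>2 + c\<^sup>2 + d\<^sup>2 + w\<^sup>2 + x\<^sup>2 + y\<^sup>2 + z\<^sup>2 = N"
      using t unfolding abc eight_squares_def by simp
    have "0 \<le> a\<^sup>2" "0 \<le> b\<^sup>2" "0 \<le> c\<^sup>2" "0 \<le> d\<^sup>2" "0 \<le> w\<^sup>2" "0 \<le> x\<^sup>2" "0 \<le> y\<^sup>2" "0 \<le> z\<^sup>2" by simp_all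
    with eq show "t \<in> ?B \<times> ?B" unfolding abc
      by (intro SigmaI square_bound) linarith+
  qed
  then show ?thesis by (rule finite_subset) simp
qed

lemma finite_eight_odd_squares [simp]: "finite (eight_odd_squares N)"
  by (rule finite_subset[OF _ finite_eight_squares[of N]]) (auto simp: eight_odd_squares_def)

text \<open>The condition says that the first four squares, and hence also the last four, have an odd sum, which is the case
  covered by Jacobi's theorem above.\<close>

lemma card_eight_squares_odd_first_half:
  assumes "0 < n" "odd n"
  shows "int (card {t \<in> eight_squares (2 * n). odd_first_half t}) = 64 * divisor_power_sum 3 n"
proof -
  have "t \<in> eight_squares (2 * n) \<and> odd_first_half t \<longleftrightarrow>
      (\<exists>i. odd i \<and> 0 < i \<and> i < 2 * n \<and> fst t \<in> four_squares i \<and> snd t \<in> four_squares (2 * n - i))" for t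
  proof -
    obtain a b c d w x y z where t: "t = ((a, b, c, d), (w, x, y, z))" by (metis prod.exhaust)
    let ?i = "a\<^sup>2 + b\<^sup>2 + c\<^sup>2 + d\<^sup>2" and ?j = "w\<^sup>2 + x\<^sup>2 + y\<^sup>2 + z\<^sup>2"
    have odd: "odd (a + b + c + d) \<longleftrightarrow> odd ?i" by simp
    have "0 \<le> ?i" "0 \<le> ?j" by simp_all
    have pos: "0 < i \<and> 0 < j" if "0 \<le> i" "0 \<le> j" "odd i" "i + j = 2 * n" for i j
      using that by presburger
    have "0 < ?i \<and> 0 < ?j" if "odd ?i" "?i + ?j = 2 * n"
      using pos \<open>0 \<le> ?i\<close> \<open>0 \<le> ?j\<close> that by blast
    then have "?i + ?j = 2 * n \<and> odd ?i \<longleftrightarrow> odd ?i \<and> 0 < ?i \<and> ?i < 2 * n \<and> ?j = 2 * n - ?i"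
      by (smt (verit))
    moreover have "?i + ?j = a\<^sup>2 + b\<^sup>2 + c\<^sup>2 + d\<^sup>2 + w\<^sup>2 + x\<^sup>2 + y\<^sup>2 + z\<^sup>2" by simp
    ultimately show ?thesis unfolding t eight_squares_def four_squares_def mem_Collect_eq
        prod.case odd_first_half.simps odd fst_conv snd_conv by metis
  qed
  then have "{t \<in> eight_squares (2 * n). odd_first_half t}
      = {(p, q). \<exists>i. odd i \<and> 0 < i \<and> i < 2 * n \<and> p \<in> four_squares i \<and> q \<in> four_squares (2 * n - i)}"
    by (auto simp: set_eq_iff)
  then have "int (card {t \<in> eight_squares (2 * n). odd_first_half t})
      = (\<Sum>i | odd i \<and> 0 < i \<and> i < 2 * n. int (card (four_squares i)) * int (card (four_squares (2 * n - i))))"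
    by (simp only:) (rule card_convolution, auto dest: four_squares_unique)
  also have "\<dots> = (\<Sum>i | odd i \<and> 0 < i \<and> i < 2 * n. 64 * (divisor_power_sum 1 i * divisor_power_sum 1 (2 * n - i)))"
    by (rule sum.cong) (auto simp: card_four_squares)
  also have "\<dots> = 64 * divisor_power_sum 3 n"
    using divisor_sum_convolution[OF assms] by (simp only: sum_distrib_left[symmetric])
  finally show ?thesis .
qed

text \<open>Four odd squares have a sum congruent to 4 modulo 8, so both halves are of the form to which
  the count of sums of four odd squares applies.\<close>

lemma card_eight_odd_squares:
  assumes "0 < n" "odd n"
  shows "int (card (eight_odd_squares (8 * n))) = 256 * divisor_power_sum 3 n"
proof -
  have "t \<in> eight_odd_squares (8 * n) \<longleftrightarrow>
      (\<exists>i. odd i \<and> 0 < i \<and> i < 2 * n \<and> fst t \<in> four_odd_squares (4 * i) \<and> snd t \<in> four_odd_squares (4 * (2 * n - i)))"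
      (is "?L \<longleftrightarrow> ?R") for t
  proof -
    obtain a b c d w x y z where t: "t = ((a, b, c, d), (w, x, y, z))" by (metis prod.exhaust)
    have four: "\<exists>i. odd i \<and> 0 < i \<and> a\<^sup>2 + b\<^sup>2 + c\<^sup>2 + d\<^sup>2 = 4 * i"
      if o: "odd a" "odd b" "odd c" "odd d" for a b c d :: int
    proof -
      have sq: "\<exists>j \<ge> 0. u\<^sup>2 = 8 * j + 1" if "odd u" for u :: int
      proof (intro exI conjI)
        show "0 \<le> u\<^sup>2 div 8" by (simp add: pos_imp_zdiv_nonneg_iff)
        show "u\<^sup>2 = 8 * (u\<^sup>2 div 8) + 1"
          using odd_square_mod_8[OF that] by (metis mult_div_mod_eq)
      qed
      obtain j k l m where "0 \<le> j" "0 \<le> k" "0 \<le> l" "0 \<le> m"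
        "a\<^sup>2 = 8 * j + 1" "b\<^sup>2 = 8 * k + 1" "c\<^sup>2 = 8 * l + 1" "d\<^sup>2 = 8 * m + 1"
        using sq[OF o(1)] sq[OF o(2)] sq[OF o(3)] sq[OF o(4)] by blast
      then show ?thesis by (intro exI[of _ "2 * (j + k + l + m) + 1"]) simp
    qed
    show ?thesis
    proof
      assume ?L
      then have o: "odd a" "odd b" "odd c" "odd d" "odd w" "odd x" "odd y" "odd z"
        and s: "a\<^sup>2 + b\<^sup>2 + c\<^sup>2 + d\<^sup>2 + w\<^sup>2 + x\<^sup>2 + y\<^sup>2 + z\<^sup>2 = 8 * n"
        by (auto simp: t eight_odd_squares_def eight_squares_def)
      obtain i where i: "odd i" "0 < i" "a\<^sup>2 + b\<^sup>2 + c\<^sup>2 + d\<^sup>2 = 4 * i" using four[OF o(1-4)] by blast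
      obtain j where j: "odd j" "0 < j" "w\<^sup>2 + x\<^sup>2 + y\<^sup>2 + z\<^sup>2 = 4 * j" using four[OF o(5-8)] by blast
      have "j = 2 * n - i" using s i j by linarith
      with i j o show ?R unfolding t four_odd_squares_def four_squares_def by auto
    next
      assume ?R then show ?L
        unfolding t by (auto simp: four_odd_squares_def four_squares_def eight_odd_squares_def eight_squares_def)
    qed
  qed
  then have "eight_odd_squares (8 * n)
      = {(p, q). \<exists>i. odd i \<and> 0 < i \<and> i < 2 * n \<and> p \<in> four_odd_squares (4 * i) \<and> q \<in> four_odd_squares (4 * (2 * n - i))}"
    by (auto simp: set_eq_iff)
  then have "int (card (eight_odd_squares (8 * n)))
      = (\<Sum>i | odd i \<and> 0 < i \<and> i < 2 * n. int (card (four_odd_squares (4 * i))) * int (card (four_odd_squares (4 * (2 * n - i)))))"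
    by (simp only:) (rule card_convolution, auto dest: four_odd_squares_unique)
  also have "\<dots> = (\<Sum>i | odd i \<and> 0 < i \<and> i < 2 * n. 256 * (divisor_power_sum 1 i * divisor_power_sum 1 (2 * n - i)))"
    by (rule sum.cong[OF refl]) (auto simp: card_four_odd_squares simp del: right_diff_distrib_numeral)
  also have "\<dots> = 256 * divisor_power_sum 3 n"
    using divisor_sum_convolution[OF assms] by (simp only: sum_distrib_left[symmetric])
  finally show ?thesis .
qed

fun total :: "int8 \<Rightarrow> int" where
  "total ((a, b, c, d), (w, x, y, z)) = a + b + c + d + w + x + y + z"

text \<open>Changing the sign of one odd entry changes the sum of the entries by 2 modulo 4.\<close>

lemma card_eight_odd_squares_total:
  assumes "0 < n" "odd n"
  shows "int (card {t \<in> eight_odd_squares (8 * n). 4 dvd total t}) = 128 * divisor_power_sum 3 n"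
proof -
  define P where "P = {t \<in> eight_odd_squares (8 * n). 4 dvd total t}"
  define Q where "Q = {t \<in> eight_odd_squares (8 * n). \<not> 4 dvd total t}"
  let ?flip = "\<lambda>((a, b, c, d), q). ((- a, b, c, d), q) :: int8"
  have fin: "finite P" "finite Q" by (auto simp: P_def Q_def)
  have "eight_odd_squares (8 * n) = P \<union> Q" "P \<inter> Q = {}" by (auto simp: P_def Q_def)
  then have "card (eight_odd_squares (8 * n)) = card P + card Q"
    using fin by (simp add: card_Un_disjoint)
  moreover have "card P = card Q"
  proof (rule bij_betw_same_card, rule bij_betw_byWitness[where f' = ?flip])
    have *: "4 dvd a + b + c + d + w + x + y + z \<longleftrightarrow> \<not> 4 dvd b - a + c + d + w + x + y + z"
      if "odd a" "odd b" "odd c" "odd d" "odd w" "odd x" "odd y" "odd z" for a b c d w x y z :: int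
      using that by presburger
    show "?flip ` P \<subseteq> Q" "?flip ` Q \<subseteq> P"
      using * by (auto simp: P_def Q_def eight_odd_squares_def eight_squares_def)
  qed auto
  ultimately show ?thesis using card_eight_odd_squares[OF assms] by (simp add: P_def)
qed

text \<open>Number the eight positions by the vectors of $F_2^3$. The seven nonzero linear functionals split them
  into two halves, and two different positions are separated by exactly four of the functionals. A vector of
  norm \<open>2 * n\<close> with \<open>n\<close> odd has two or six odd entries, so exactly four of the seven splittings
  give two halves with odd sums. Each summand below belongs to one half of one splitting.\<close>

lemma seven_splittings:
  assumes "((a, b, c, d), (w, x, y, z)) \<in> eight_squares (2 * n)" "odd n"
  shows "of_bool (odd (a + b + c + d)) + of_bool (odd (x + b + z + d)) + of_bool (odd (y + z + c + d))
    + of_bool (odd (x + b + c + y)) + of_bool (odd (w + b + y + d)) + of_bool (odd (w + x + c + d))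
    + of_bool (odd (w + b + c + z)) = (4 :: int)"
proof -
  have "a\<^sup>2 + b\<^sup>2 + c\<^sup>2 + d\<^sup>2 + w\<^sup>2 + x\<^sup>2 + y\<^sup>2 + z\<^sup>2 = 2 * n"
    using assms(1) by (simp add: eight_squares_def)
  moreover have "2 * n mod 4 = 2" using assms(2) by presburger
  ultimately have "(a\<^sup>2 + b\<^sup>2 + c\<^sup>2 + d\<^sup>2 + w\<^sup>2 + x\<^sup>2 + y\<^sup>2 + z\<^sup>2) mod 4 = 2"
    by (simp only:)
  moreover have "(of_bool (odd a) + of_bool (odd b) + of_bool (odd c) + of_bool (odd d)
      + of_bool (odd w) + of_bool (odd x) + of_bool (odd y) + of_bool (odd z)) mod (4 :: int)
      = (a\<^sup>2 + b\<^sup>2 + c\<^sup>2 + d\<^sup>2 + w\<^sup>2 + x\<^sup>2 + y\<^sup>2 + z\<^sup>2) mod 4"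
    by (intro mod_add_cong) (simp_all add: square_mod_4)
  ultimately have *: "(of_bool (odd a) + of_bool (odd b) + of_bool (odd c) + of_bool (odd d)
      + of_bool (odd w) + of_bool (odd x) + of_bool (odd y) + of_bool (odd z)) mod 4 = (2 :: int)"
    by (simp only:)
  (* The oddness of a sum of four entries as an exclusive disjunction leaves a purely propositional claim. *)
  have parity: "of_bool ((A \<noteq> B) \<noteq> (C \<noteq> D)) + of_bool ((X \<noteq> B) \<noteq> (Z \<noteq> D)) + of_bool ((Y \<noteq> Z) \<noteq> (C \<noteq> D))
      + of_bool ((X \<noteq> B) \<noteq> (C \<noteq> Y)) + of_bool ((W \<noteq> B) \<noteq> (Y \<noteq> D)) + of_bool ((W \<noteq> X) \<noteq> (C \<noteq> D))
      + of_bool ((W \<noteq> B) \<noteq> (C \<noteq> Z)) = (4 :: int)"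
    if "(of_bool A + of_bool B + of_bool C + of_bool D + of_bool W + of_bool X + of_bool Y + of_bool Z) mod 4 = (2 :: int)"
    for A B C D W X Y Z
    using that by (cases A; cases B; cases C; cases D; cases W; cases X; cases Y; cases Z) simp_all
  have odd4: "odd (p + q + s + t) \<longleftrightarrow> (odd p \<noteq> odd q) \<noteq> (odd s \<noteq> odd t)" for p q s t :: int by auto
  show ?thesis unfolding odd4 by (rule parity[OF *])
qed

text \<open>Every vector is counted by four of the seven splittings, and each splitting is carried to the
  splitting into first and second half by a permutation of the entries that is an involution.\<close>

lemma card_eight_squares:
  assumes "0 < n" "odd n"
  shows "int (card (eight_squares (2 * n))) = 112 * divisor_power_sum 3 n"
proof -
  let ?S = "eight_squares (2 * n)"
  let ?ind = "\<lambda>t. of_bool (odd_first_half t) :: int"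
  have inv: "(\<Sum>t \<in> ?S. g t) = (\<Sum>t \<in> ?S. ?ind t)"
    if "\<And>t. t \<in> ?S \<Longrightarrow> \<tau> t \<in> ?S" "\<And>t. \<tau> (\<tau> t) = t" "\<And>t. g t = ?ind (\<tau> t)" for \<tau> g
    by (rule sum.reindex_bij_witness[of _ \<tau> \<tau>]) (use that in auto)
  have 1: "(\<Sum>((a, b, c, d), (w, x, y, z)) \<in> ?S. of_bool (odd (x + b + z + d))) = (\<Sum>t \<in> ?S. ?ind t)"
    by (rule inv[of "\<lambda>((a, b, c, d), (w, x, y, z)). ((x, b, z, d), (w, a, y, c))"])
       (simp_all add: split_paired_all eight_squares_def ac_simps)
  have 2: "(\<Sum>((a, b, c, d), (w, x, y, z)) \<in> ?S. of_bool (odd (y + z + c + d))) = (\<Sum>t \<in> ?S. ?ind t)"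
    by (rule inv[of "\<lambda>((a, b, c, d), (w, x, y, z)). ((y, z, c, d), (w, x, a, b))"])
       (simp_all add: split_paired_all eight_squares_def ac_simps)
  have 3: "(\<Sum>((a, b, c, d), (w, x, y, z)) \<in> ?S. of_bool (odd (x + b + c + y))) = (\<Sum>t \<in> ?S. ?ind t)"
    by (rule inv[of "\<lambda>((a, b, c, d), (w, x, y, z)). ((x, b, c, y), (w, a, d, z))"])
       (simp_all add: split_paired_all eight_squares_def ac_simps)
  have 4: "(\<Sum>((a, b, c, d), (w, x, y, z)) \<in> ?S. of_bool (odd (w + b + y + d))) = (\<Sum>t \<in> ?S. ?ind t)"
    by (rule inv[of "\<lambda>((a, b, c, d), (w, x, y, z)). ((w, b, y, d), (a, x, c, z))"])
       (simp_all add: split_paired_all eight_squares_def ac_simps)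
  have 5: "(\<Sum>((a, b, c, d), (w, x, y, z)) \<in> ?S. of_bool (odd (w + x + c + d))) = (\<Sum>t \<in> ?S. ?ind t)"
    by (rule inv[of "\<lambda>((a, b, c, d), (w, x, y, z)). ((w, x, c, d), (a, b, y, z))"])
       (simp_all add: split_paired_all eight_squares_def ac_simps)
  have 6: "(\<Sum>((a, b, c, d), (w, x, y, z)) \<in> ?S. of_bool (odd (w + b + c + z))) = (\<Sum>t \<in> ?S. ?ind t)"
    by (rule inv[of "\<lambda>((a, b, c, d), (w, x, y, z)). ((w, b, c, z), (a, x, y, d))"])
       (simp_all add: split_paired_all eight_squares_def ac_simps)
  have "4 * int (card ?S) = (\<Sum>t \<in> ?S. 4)" by simp
  also have "\<dots> = (\<Sum>((a, b, c, d), (w, x, y, z)) \<in> ?S. of_bool (odd (a + b + c + d)) + of_bool (odd (x + b + z + d)) + of_bool (odd (y + z + c + d))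
    + of_bool (odd (x + b + c + y)) + of_bool (odd (w + b + y + d)) + of_bool (odd (w + x + c + d))
    + of_bool (odd (w + b + c + z)))"
  proof (rule sum.cong[OF refl])
    fix t assume t: "t \<in> ?S"
    obtain a b c d w x y z where abc: "t = ((a, b, c, d), (w, x, y, z))" by (metis prod.exhaust)
    show "4 = (\<lambda>((a, b, c, d), (w, x, y, z)). of_bool (odd (a + b + c + d)) + of_bool (odd (x + b + z + d))
      + of_bool (odd (y + z + c + d)) + of_bool (odd (x + b + c + y)) + of_bool (odd (w + b + y + d))
      + of_bool (odd (w + x + c + d)) + (of_bool (odd (w + b + c + z)) :: int)) t"
      unfolding abc prod.case
      by (rule seven_splittings[OF t[unfolded abc] assms(2), symmetric])
  qed
  also have "\<dots> = (\<Sum>((a, b, c, d), (w, x, y, z)) \<in> ?S. of_bool (odd (a + b + c + d))) + 6 * (\<Sum>t \<in> ?S. ?ind t)"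
    using 1 2 3 4 5 6 by (simp only: sum.distrib case_prod_unfold)
  also have "(\<Sum>((a, b, c, d), (w, x, y, z)) \<in> ?S. of_bool (odd (a + b + c + d))) = (\<Sum>t \<in> ?S. ?ind t)"
    by (rule sum.cong) auto
  also have "(\<Sum>t \<in> ?S. ?ind t) = int (card {t \<in> ?S. odd_first_half t})"
    by (simp add: Int_def)
  finally show ?thesis using card_eight_squares_odd_first_half[OF assms] by simp
qed

section \<open>The two lattices in dimension four\<close>

lemma square_mod_4_sum:
  "(a\<^sup>2 + b\<^sup>2 + c\<^sup>2 + d\<^sup>2) mod 4 = (of_bool (odd a) + of_bool (odd b) + of_bool (odd c) + of_bool (odd d)) mod (4 :: int)"
  by (intro mod_add_cong) (simp_all add: square_mod_4)

text \<open>The propositions stand for the oddness of the four entries, so that \<open>C \<longleftrightarrow> \<not> D\<close> says that the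
  last two entries have an odd sum.\<close>

lemma odd_count_mod_4:
  assumes "p mod 4 = (of_bool A + of_bool B + of_bool C + of_bool D) mod (4 :: int)"
  shows "p mod 4 = 1 \<Longrightarrow> (\<not> A \<and> \<not> B \<longleftrightarrow> \<not> (\<not> C \<and> \<not> D)) \<and> ((A \<longleftrightarrow> B) \<longleftrightarrow> (C \<longleftrightarrow> \<not> D))"
    and "p mod 4 = 3 \<Longrightarrow> (A \<and> B \<longleftrightarrow> \<not> (C \<and> D)) \<and> ((A \<longleftrightarrow> B) \<longleftrightarrow> (C \<longleftrightarrow> \<not> D))"
    and "\<not> A \<Longrightarrow> \<not> B \<Longrightarrow> (C \<longleftrightarrow> \<not> D) \<Longrightarrow> p mod 4 = 1"
    and "A \<Longrightarrow> B \<Longrightarrow> (C \<longleftrightarrow> \<not> D) \<Longrightarrow> p mod 4 = 3"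
  using assms by (cases A; cases B; cases C; cases D; simp)+

text \<open>A rotation by 45 degrees in the last two coordinates turns both translated lattices in dimension four into
  sets of integer vectors that are cut out by these parity conditions.\<close>

definition pair_parity :: "bool \<Rightarrow> int \<times> int \<times> int \<times> int \<Rightarrow> bool" where
  "pair_parity odd12 = (\<lambda>(a, b, c, d). (odd a \<longleftrightarrow> odd12) \<and> (odd b \<longleftrightarrow> odd12) \<and> odd (c + d))"

text \<open>Modulo 4 the number \<open>n\<close> counts the odd entries. If \<open>n mod 4\<close> is 1 or 3, exactly one entry differs in parity
  from the other three, and the condition says that it is one of the last two. Swapping the first two entries with the last two
  shows that this holds for half of all representations.\<close>

lemma card_pair_parity:
  assumes "0 < n"
  shows "int (card {q \<in> four_squares n. pair_parity odd12 q}) =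
    (if n mod 4 = (if odd12 then 3 else 1) then 4 * divisor_power_sum 1 n else 0)"
proof (cases "n mod 4 = (if odd12 then 3 else 1)")
  case False
  have "n mod 4 = (if odd12 then 3 else 1)" if "pair_parity odd12 q" "q \<in> four_squares n" for q
  proof -
    obtain a b c d where q: "q = (a, b, c, d)" by (cases q) auto
    have n: "n mod 4 = (of_bool (odd a) + of_bool (odd b) + of_bool (odd c) + of_bool (odd d)) mod 4"
      using that(2) square_mod_4_sum[of a b c d] by (simp add: q four_squares_def)
    show ?thesis
      using that(1) odd_count_mod_4(3,4)[OF n] by (cases odd12) (auto simp: q pair_parity_def)
  qed
  with False have "{q \<in> four_squares n. pair_parity odd12 q} = {}" by blast
  with False show ?thesis by simp
next
  case True
  then have "odd n" by (cases odd12) (simp_all, presburger+)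
  define P where "P = {q \<in> four_squares n. pair_parity odd12 q}"
  define Q where "Q = {q \<in> four_squares n. \<not> pair_parity odd12 q}"
  let ?swap = "\<lambda>(a, b, c, d). (c, d, a, b) :: int \<times> int \<times> int \<times> int"
  have *: "pair_parity odd12 (c, d, a, b) \<longleftrightarrow> \<not> pair_parity odd12 (a, b, c, d)"
    if "(a, b, c, d) \<in> four_squares n" for a b c d
  proof -
    have n: "n mod 4 = (of_bool (odd a) + of_bool (odd b) + of_bool (odd c) + of_bool (odd d)) mod 4"
      using that square_mod_4_sum[of a b c d] by (simp add: four_squares_def)
    show ?thesis
      using True odd_count_mod_4(1,2)[OF n] by (cases odd12) (auto simp: pair_parity_def)
  qed
  have fin: "finite P" "finite Q" by (auto simp: P_def Q_def)
  have "four_squares n = P \<union> Q" "P \<inter> Q = {}" by (auto simp: P_def Q_def)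
  then have "card (four_squares n) = card P + card Q"
    using fin by (simp add: card_Un_disjoint)
  moreover have "card P = card Q"
  proof (rule bij_betw_same_card, rule bij_betw_byWitness[where f' = ?swap])
    have PQ: "(c, d, a, b) \<in> Q" if "(a, b, c, d) \<in> P" for a b c d
      using that *[of a b c d] by (simp add: P_def Q_def four_squares_def)
    have QP: "(c, d, a, b) \<in> P" if "(a, b, c, d) \<in> Q" for a b c d
      using that *[of a b c d] by (simp add: P_def Q_def four_squares_def)
    show "?swap ` P \<subseteq> Q" using PQ by auto
    show "?swap ` Q \<subseteq> P" using QP by auto
  qed auto
  ultimately show ?thesis using True card_four_squares[OF assms \<open>odd n\<close>] by (simp add: P_def)
qed

lemma vector_4:
  "(vector [w, x, y, z] :: 'a :: zero ^ 4) $ 1 = w" "(vector [w, x, y, z] :: 'a ^ 4) $ 2 = x"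
  "(vector [w, x, y, z] :: 'a ^ 4) $ 3 = y" "(vector [w, x, y, z] :: 'a ^ 4) $ 4 = z"
  by (simp_all add: vector_def)

definition rotated4 :: "int \<times> int \<times> int \<times> int \<Rightarrow> real ^ 4" where
  "rotated4 = (\<lambda>(a, b, c, d). vector [of_int a, of_int b, of_int (c + d) / sqrt 2, of_int (c - d) / sqrt 2])"

lemma norm_rotated4: "(norm (rotated4 (a, b, c, d)))\<^sup>2 = of_int (a\<^sup>2 + b\<^sup>2 + c\<^sup>2 + d\<^sup>2)"
proof -
  have "(norm (rotated4 (a, b, c, d)))\<^sup>2
      = (of_int a)\<^sup>2 + (of_int b)\<^sup>2 + (of_int (c + d))\<^sup>2 / 2 + (of_int (c - d))\<^sup>2 / (2 :: real)"
    unfolding power2_norm_eq_inner inner_vec_def sum_4 rotated4_def prod.case vector_4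
    by (simp add: power2_eq_square)
  also have "\<dots> = of_int (a\<^sup>2 + b\<^sup>2 + c\<^sup>2 + d\<^sup>2)"
    by (simp add: power2_eq_square field_simps)
  finally show ?thesis .
qed

lemma inj_rotated4: "inj rotated4"
proof (rule injI)
  fix p q assume eq: "rotated4 p = rotated4 q"
  obtain a b c d where p: "p = (a, b, c, d)" by (cases p) auto
  obtain a' b' c' d' where q: "q = (a', b', c', d')" by (cases q) auto
  have "real_of_int a = of_int a' \<and> real_of_int b = of_int b' \<and>
      real_of_int (c + d) = of_int (c' + d') \<and> real_of_int (c - d) = of_int (c' - d')"
    using eq unfolding p q vec_eq_iff forall_4 rotated4_def prod.case vector_4 by simp
  then have "a = a'" "b = b'" "c + d = c' + d'" "c - d = c' - d'" by (simp_all only: of_int_eq_iff)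
  then show "p = q" unfolding p q by simp
qed

lemma r_rotated4: "r (rotated4 ` {q. P q}) n = card {q \<in> four_squares n. P q}"
proof -
  have "{x \<in> rotated4 ` {q. P q}. (norm x)\<^sup>2 = of_int n} = rotated4 ` {q \<in> four_squares n. P q}"
    by (auto simp: norm_rotated4 four_squares_def simp del: of_int_add of_int_power)
  then show ?thesis
    unfolding r_def by (simp add: card_image inj_on_subset[OF inj_rotated4])
qed

lemma rotated4_coset:
  "rotated4 ` {q. pair_parity odd12 q} =
     {vector [of_int (2 * a + of_bool odd12), of_int (2 * b + of_bool odd12), sqrt 2 * (of_int c + 1 / 2), sqrt 2 * (of_int d + 1 / 2)]
      | a b c d. True}" (is "?L = ?R")
proof -
  have half: "of_int (2 * k + 1) / sqrt 2 = sqrt 2 * (of_int k + 1 / 2)" for k :: int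
    by (simp add: field_simps)
  have eq: "rotated4 (2 * a + of_bool odd12, 2 * b + of_bool odd12, c + d + 1, c - d)
     = vector [of_int (2 * a + of_bool odd12), of_int (2 * b + of_bool odd12), sqrt 2 * (of_int c + 1 / 2), sqrt 2 * (of_int d + 1 / 2)]"
    for a b c d
  proof -
    have "(c + d + 1) + (c - d) = 2 * c + 1" "(c + d + 1) - (c - d) = 2 * d + 1" by simp_all
    then show ?thesis unfolding rotated4_def prod.case half[symmetric] by (simp only:)
  qed
  have "\<exists>a b c d. q = (2 * a + of_bool odd12, 2 * b + of_bool odd12, c + d + 1, c - d)" if "pair_parity odd12 q" for q
  proof -
    obtain w x y z where q: "q = (w, x, y, z)" by (cases q) auto
    have *: "odd w = odd12" "odd x = odd12" "odd (y + z)" using that by (auto simp: q pair_parity_def)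
    have "w = 2 * (w div 2) + of_bool odd12" "x = 2 * (x div 2) + of_bool odd12"
      using * by (cases odd12; simp)+
    moreover have "y = (y + z - 1) div 2 + (y - z - 1) div 2 + 1" "z = (y + z - 1) div 2 - (y - z - 1) div 2"
      using *(3) by presburger+
    ultimately show ?thesis unfolding q by blast
  qed
  moreover have "pair_parity odd12 (2 * a + of_bool odd12, 2 * b + of_bool odd12, c + d + 1, c - d)" for a b c d
    by (cases odd12) (simp_all add: pair_parity_def)
  ultimately have S: "{q. pair_parity odd12 q} = {(2 * a + of_bool odd12, 2 * b + of_bool odd12, c + d + 1, c - d) | a b c d. True}"
    by blast
  show ?thesis unfolding S eq[symmetric] by blast
qed

lemma L1_eq: "L1 = rotated4 ` {q. pair_parity False q}"
proof -
  have "of_int a *\<^sub>R vector [2, 0, 0, 0] + of_int b *\<^sub>R vector [0, 2, 0, 0]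
       + of_int c *\<^sub>R vector [0, 0, sqrt 2, 0] + of_int d *\<^sub>R vector [0, 0, 0, sqrt 2]
       + (1 / sqrt 2) *\<^sub>R vector [0, 0, 1, 1]
     = (vector [of_int (2 * a + of_bool False), of_int (2 * b + of_bool False), sqrt 2 * (of_int c + 1 / 2), sqrt 2 * (of_int d + 1 / 2)] :: real ^ 4)"
    for a b c d :: int
    by (simp add: vec_eq_iff forall_4 vector_4 field_simps)
  then show ?thesis unfolding rotated4_coset L1_def by (simp only:)
qed

lemma L2_eq: "L2 = rotated4 ` {q. pair_parity True q}"
proof -
  have "of_int a *\<^sub>R vector [2, 0, 0, 0] + of_int b *\<^sub>R vector [0, 2, 0, 0]
       + of_int c *\<^sub>R vector [0, 0, sqrt 2, 0] + of_int d *\<^sub>R vector [0, 0, 0, sqrt 2]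
       + (1 / sqrt 2) *\<^sub>R vector [sqrt 2, sqrt 2, 1, 1]
     = (vector [of_int (2 * a + of_bool True), of_int (2 * b + of_bool True), sqrt 2 * (of_int c + 1 / 2), sqrt 2 * (of_int d + 1 / 2)] :: real ^ 4)"
    for a b c d :: int
    by (simp add: vec_eq_iff forall_4 vector_4 field_simps)
  then show ?thesis unfolding rotated4_coset L2_def by (simp only:)
qed

theorem r_L1: "0 < n \<Longrightarrow> int (r L1 n) = (if n mod 4 = 1 then 4 * divisor_power_sum 1 n else 0)"
  using card_pair_parity[of n False] by (simp add: L1_eq r_rotated4)

theorem r_L2: "0 < n \<Longrightarrow> int (r L2 n) = (if n mod 4 = 3 then 4 * divisor_power_sum 1 n else 0)"
  using card_pair_parity[of n True] by (simp add: L2_eq r_rotated4)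

section \<open>The theta series of the $E_8$ lattice\<close>

lemma UNIV_8: "(UNIV :: 8 set) = {1, 2, 3, 4, 5, 6, 7, 8}"
proof -
  have "x \<in> {1, 2, 3, 4, 5, 6, 7, 8}" for x :: 8
  proof (induct x)
    case (of_int z)
    then have "z \<in> {0, 1, 2, 3, 4, 5, 6, 7}" by auto
    then show ?case by auto
  qed
  then show ?thesis by blast
qed

lemma forall_8: "(\<forall>i :: 8. P i) \<longleftrightarrow> P 1 \<and> P 2 \<and> P 3 \<and> P 4 \<and> P 5 \<and> P 6 \<and> P 7 \<and> P 8"
  by (metis UNIV_8 UNIV_I insert_iff empty_iff)

lemma sum_8: "sum f (UNIV :: 8 set) = f 1 + f 2 + f 3 + f 4 + f 5 + f 6 + f 7 + f 8"
  unfolding UNIV_8 by (simp add: ac_simps)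

lemma vector_8:
  fixes a b c d w x y z :: real
  defines "v \<equiv> vector [a, b, c, d, w, x, y, z] :: real ^ 8"
  shows "v $ 1 = a" "v $ 2 = b" "v $ 3 = c" "v $ 4 = d" "v $ 5 = w" "v $ 6 = x" "v $ 7 = y" "v $ 8 = z"
  by (simp_all add: v_def vector_def)

lemma sum_1_6: "(\<Sum>i = 1..6. f i) = f 1 + f 2 + f 3 + f 4 + f 5 + f (6 :: nat)" for f :: "nat \<Rightarrow> 'a :: comm_monoid_add"
proof -
  have "{1..6} = {1, 2, 3, 4, 5, 6 :: nat}" by auto
  then show ?thesis by (simp add: ac_simps)
qed

lemma sum_1_8: "(\<Sum>i = 1..8. f i) = f 1 + f 2 + f 3 + f 4 + f 5 + f 6 + f 7 + f (8 :: nat)" for f :: "nat \<Rightarrow> 'a :: comm_monoid_add"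
proof -
  have "{1..8} = {1, 2, 3, 4, 5, 6, 7, 8 :: nat}" by auto
  then show ?thesis by (simp add: ac_simps)
qed

text \<open>The entries are halved so that all of $E_8$ has integer coordinates.\<close>

definition half8 :: "int8 \<Rightarrow> real ^ 8" where
  "half8 = (\<lambda>((a, b, c, d), (w, x, y, z)). vector [of_int a / 2, of_int b / 2, of_int c / 2, of_int d / 2,
     of_int w / 2, of_int x / 2, of_int y / 2, of_int z / 2])"

lemma norm_half8: "(norm (half8 ((a, b, c, d), (w, x, y, z))))\<^sup>2
   = of_int (a\<^sup>2 + b\<^sup>2 + c\<^sup>2 + d\<^sup>2 + w\<^sup>2 + x\<^sup>2 + y\<^sup>2 + z\<^sup>2) / 4"
  unfolding power2_norm_eq_inner inner_vec_def sum_8 half8_def prod.case vector_8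
  by (simp add: power2_eq_square)

lemma inj_half8: "inj half8"
proof (rule injI)
  fix s t assume eq: "half8 s = half8 t"
  obtain a b c d w x y z where s: "s = ((a, b, c, d), (w, x, y, z))" by (metis prod.exhaust)
  obtain a' b' c' d' w' x' y' z' where t: "t = ((a', b', c', d'), (w', x', y', z'))" by (metis prod.exhaust)
  show "s = t" using eq unfolding s t vec_eq_iff forall_8 half8_def prod.case vector_8 by simp
qed

definition same_parity :: "int8 \<Rightarrow> bool" where
  "same_parity = (\<lambda>((a, b, c, d), (w, x, y, z)).
     even (a - z) \<and> even (b - z) \<and> even (c - z) \<and> even (d - z) \<and> even (w - z) \<and> even (x - z) \<and> even (y - z))"

lemma E8_member:
  "of_int a *\<^sub>R (2 *\<^sub>R e 1) + (\<Sum>i = 1..6. of_int (b i) *\<^sub>R (e (i + 1) - e i))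
     + of_int c *\<^sub>R ((1 / 2) *\<^sub>R (\<Sum>i = 1..8. e i))
   = half8 ((4 * a - 2 * b 1 + c, 2 * b 1 - 2 * b 2 + c, 2 * b 2 - 2 * b 3 + c, 2 * b 3 - 2 * b 4 + c),
       (2 * b 4 - 2 * b 5 + c, 2 * b 5 - 2 * b 6 + c, 2 * b 6 + c, c))"
  unfolding sum_1_6 sum_1_8 vec_eq_iff forall_8 half8_def prod.case vector_8
  by (simp add: e_def axis_def)

text \<open>The coordinates of a lattice vector determine the coefficients of the basis one after the other, from the
  last to the first; the condition on the sum is what makes the coefficient of $2 e_1$ an integer.\<close>

lemma E8_eq: "E8 = half8 ` {t. same_parity t \<and> 4 dvd total t}" (is "_ = half8 ` ?T")
proof
  show "E8 \<subseteq> half8 ` ?T"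
  proof
    fix v assume "v \<in> E8"
    then obtain a b c where v: "v = half8 ((4 * a - 2 * b 1 + c, 2 * b 1 - 2 * b 2 + c, 2 * b 2 - 2 * b 3 + c, 2 * b 3 - 2 * b 4 + c),
       (2 * b 4 - 2 * b 5 + c, 2 * b 5 - 2 * b 6 + c, 2 * b (6 :: nat) + c, c))"
      unfolding E8_def E8_member by blast
    show "v \<in> half8 ` ?T"
      unfolding v by (rule imageI) (simp add: same_parity_def)
  qed
  show "half8 ` ?T \<subseteq> E8"
  proof
    fix v assume "v \<in> half8 ` ?T"
    then obtain t where t: "same_parity t" "4 dvd total t" "v = half8 t" by blast
    obtain a b c d w x y z where abc: "t = ((a, b, c, d), (w, x, y, z))" by (metis prod.exhaust)
    from t(1) have "even (b - z)" "even (c - z)" "even (d - z)" "even (w - z)" "even (x - z)" "even (y - z)"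
      by (simp_all add: abc same_parity_def)
    then obtain b' c' d' w' x' y' where eq:
      "b - z = 2 * b'" "c - z = 2 * c'" "d - z = 2 * d'" "w - z = 2 * w'" "x - z = 2 * x'" "y - z = 2 * y'"
      unfolding dvd_def by blast
    from t(2) have "4 dvd a + b + c + d + w + x + y + z" by (simp add: abc)
    then obtain k where k: "a + b + c + d + w + x + y + z = 4 * k" unfolding dvd_def by blast
    (* The entry 0 only pads the list, since the coefficients are numbered from 1. *)
    define \<beta> where "\<beta> i = [0, b' + c' + d' + w' + x' + y', c' + d' + w' + x' + y', d' + w' + x' + y', w' + x' + y', x' + y', y'] ! i" for i
    have "t = ((4 * (k - 2 * z) - 2 * \<beta> 1 + z, 2 * \<beta> 1 - 2 * \<beta> 2 + z, 2 * \<beta> 2 - 2 * \<beta> 3 + z, 2 * \<beta> 3 - 2 * \<beta> 4 + z),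
       (2 * \<beta> 4 - 2 * \<beta> 5 + z, 2 * \<beta> 5 - 2 * \<beta> 6 + z, 2 * \<beta> 6 + z, z))"
      using eq k unfolding abc \<beta>_def by simp
    then show "v \<in> E8" unfolding t(3) E8_def E8_member by blast
  qed
qed

text \<open>The first summand counts the vectors with half-integral entries. The second one counts those with integral
  entries; the sum of their entries is even as soon as their norm is.\<close>

lemma r_E8_split:
  "r E8 (2 * n) = card {t \<in> eight_odd_squares (8 * n). 4 dvd total t} + card (eight_squares (2 * n))"
proof -
  let ?O = "{t \<in> eight_odd_squares (8 * n). 4 dvd total t}"
  let ?dbl = "\<lambda>((a, b, c, d), (w, x, y, z)). ((2 * a, 2 * b, 2 * c, 2 * d), (2 * w, 2 * x, 2 * y, 2 * z)) :: int8"
  let ?Ev = "?dbl ` eight_squares (2 * n)"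
  have norm: "(norm (half8 t))\<^sup>2 = of_int (2 * n) \<longleftrightarrow> t \<in> eight_squares (8 * n)" for t
  proof -
    obtain a b c d w x y z where abc: "t = ((a, b, c, d), (w, x, y, z))" by (metis prod.exhaust)
    have quarter: "of_int m / 4 = (of_int (2 * n) :: real) \<longleftrightarrow> m = 8 * n" for m
      by (simp add: field_simps) linarith
    show ?thesis unfolding abc norm_half8 quarter eight_squares_def by simp
  qed
  have "{v \<in> E8. (norm v)\<^sup>2 = of_int (2 * n)} = half8 ` {t \<in> eight_squares (8 * n). same_parity t \<and> 4 dvd total t}"
    unfolding E8_eq using norm by blast
  then have "r E8 (2 * n) = card {t \<in> eight_squares (8 * n). same_parity t \<and> 4 dvd total t}"
    unfolding r_def by (simp add: card_image inj_on_subset[OF inj_half8])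
  also have "{t \<in> eight_squares (8 * n). same_parity t \<and> 4 dvd total t} = ?O \<union> ?Ev"
  proof (intro equalityI subsetI)
    fix t assume t: "t \<in> {t \<in> eight_squares (8 * n). same_parity t \<and> 4 dvd total t}"
    obtain a b c d w x y z where abc: "t = ((a, b, c, d), (w, x, y, z))" by (metis prod.exhaust)
    show "t \<in> ?O \<union> ?Ev"
    proof (cases "odd z")
      case True
      then have "t \<in> ?O" using t by (auto simp: abc eight_odd_squares_def same_parity_def)
      then show ?thesis ..
    next
      case False
      then have "even a" "even b" "even c" "even d" "even w" "even x" "even y" "even z"
        using t by (simp_all add: abc same_parity_def)
      then obtain a' b' c' d' w' x' y' z' where eq: "a = 2 * a'" "b = 2 * b'" "c = 2 * c'" "d = 2 * d'"
        "w = 2 * w'" "x = 2 * x'" "y = 2 * y'" "z = 2 * z'" unfolding dvd_def by blast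
      have "((a', b', c', d'), (w', x', y', z')) \<in> eight_squares (2 * n)"
        using t by (simp add: abc eq eight_squares_def)
      then have "?dbl ((a', b', c', d'), (w', x', y', z')) \<in> ?Ev" by (rule imageI)
      then show ?thesis by (simp add: abc eq)
    qed
  next
    fix t assume "t \<in> ?O \<union> ?Ev"
    then show "t \<in> {t \<in> eight_squares (8 * n). same_parity t \<and> 4 dvd total t}"
    proof
      assume "t \<in> ?O" then show ?thesis by (auto simp: eight_odd_squares_def same_parity_def)
    next
      assume "t \<in> ?Ev"
      then obtain a b c d w x y z where t: "t = ?dbl ((a, b, c, d), (w, x, y, z))"
        and s: "a\<^sup>2 + b\<^sup>2 + c\<^sup>2 + d\<^sup>2 + w\<^sup>2 + x\<^sup>2 + y\<^sup>2 + z\<^sup>2 = 2 * n"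
        unfolding eight_squares_def by blast
      have "even (a\<^sup>2 + b\<^sup>2 + c\<^sup>2 + d\<^sup>2 + w\<^sup>2 + x\<^sup>2 + y\<^sup>2 + z\<^sup>2)" unfolding s by simp
      then have "even (a + b + c + d + w + x + y + z)" by simp
      then obtain k where "a + b + c + d + w + x + y + z = 2 * k" by (rule evenE)
      then have "2 * a + 2 * b + 2 * c + 2 * d + 2 * w + 2 * x + 2 * y + 2 * z = 4 * k" by linarith
      then have "4 dvd total t" unfolding t by simp
      moreover have "t \<in> eight_squares (8 * n)" using s unfolding t eight_squares_def by simp
      ultimately show ?thesis by (simp add: t same_parity_def)
    qed
  qed
  also have "card (?O \<union> ?Ev) = card ?O + card ?Ev"
  proof (rule card_Un_disjoint)
    show "finite ?O" "finite ?Ev" by simp_all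
    show "?O \<inter> ?Ev = {}" by (auto simp: eight_odd_squares_def)
  qed
  also have "card ?Ev = card (eight_squares (2 * n))"
    by (rule card_image) (auto simp: inj_on_def)
  finally show ?thesis .
qed

theorem r_E8_odd: "0 < n \<Longrightarrow> odd n \<Longrightarrow> int (r E8 (2 * n)) = 240 * divisor_power_sum 3 n"
  by (simp add: r_E8_split card_eight_squares card_eight_odd_squares_total)

lemma divisor_power_sum_pos: "0 < n \<Longrightarrow> 0 < divisor_power_sum k n"
  unfolding divisor_power_sum_def by (rule sum_pos) (auto intro: finite_divisors exI[of _ 1])

text \<open>The odd part is handled by the exact count; the map $(a, b) \mapsto (a + b, a - b)$ on pairs of
  entries doubles the norm.\<close>

lemma eight_squares_nonempty: "0 < n \<Longrightarrow> eight_squares (2 * n) \<noteq> {}"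
proof (induction "nat n" arbitrary: n rule: less_induct)
  case less
  show ?case
  proof (cases "even n")
    case True
    then obtain m where m: "n = 2 * m" by (rule evenE)
    with less have "eight_squares (2 * m) \<noteq> {}" by auto
    then obtain a b c d w x y z where "a\<^sup>2 + b\<^sup>2 + c\<^sup>2 + d\<^sup>2 + w\<^sup>2 + x\<^sup>2 + y\<^sup>2 + z\<^sup>2 = 2 * m"
      unfolding eight_squares_def by blast
    then have "((a + b, a - b, c + d, c - d), (w + x, w - x, y + z, y - z)) \<in> eight_squares (2 * n)"
      unfolding eight_squares_def m by (simp add: power2_sum power2_diff)
    then show ?thesis by blast
  next
    case False
    then have "0 < int (card (eight_squares (2 * n)))"
      using less.prems by (simp add: card_eight_squares divisor_power_sum_pos)
    then show ?thesis by auto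
  qed
qed

theorem r_E8_pos: "0 < n \<Longrightarrow> 0 < r E8 (2 * n)"
  using eight_squares_nonempty[of n] by (simp add: r_E8_split card_gt_0_iff)

section \<open>Comparing divisor sums\<close>

text \<open>The divisors 1 and \<open>n\<close> contribute $n^2 - n$ and $n(1 - n)$, which cancel.\<close>

lemma divisor_power_sum_defect:
  assumes "2 \<le> n"
  shows "(n\<^sup>2 - n + 1) * divisor_power_sum 1 n - divisor_power_sum 3 n
    = (\<Sum>d | 1 < d \<and> d < n \<and> d dvd n. d * (n\<^sup>2 - n + 1 - d\<^sup>2))"
proof -
  let ?D = "{d. 0 < d \<and> d dvd n}" and ?E = "{d. 1 < d \<and> d < n \<and> d dvd n}"
  let ?t = "\<lambda>d. d * (n\<^sup>2 - n + 1 - d\<^sup>2)"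
  have finE: "finite ?E" by (rule finite_subset[of _ "{0..n}"]) auto
  have "(n\<^sup>2 - n + 1) * divisor_power_sum 1 n - divisor_power_sum 3 n = sum ?t ?D"
    unfolding divisor_power_sum_def sum_distrib_left sum_subtractf[symmetric]
    by (rule sum.cong) (auto simp: algebra_simps power2_eq_square power3_eq_cube)
  also have "?D = insert 1 (insert n ?E)"
    using assms by (auto dest: zdvd_imp_le)
  also have "sum ?t \<dots> = ?t 1 + ?t n + sum ?t ?E"
    using assms finE by simp
  also have "?t 1 + ?t n = 0" by (simp add: algebra_simps power2_eq_square)
  finally show ?thesis by simp
qed

lemma divisor_power_sum_prime:
  assumes "prime n"
  shows "(n\<^sup>2 - n + 1) * divisor_power_sum 1 n = divisor_power_sum 3 n"
proof -
  have dd: "d = 1 \<or> d = n" if "0 < d" "d dvd n" for d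
    using assms that unfolding prime_int_iff by auto
  have E: "{d. 1 < d \<and> d < n \<and> d dvd n} = {}"
  proof (rule equals0I)
    fix d assume "d \<in> {d. 1 < d \<and> d < n \<and> d dvd n}"
    then have "0 < d" "d dvd n" "d \<noteq> 1" "d \<noteq> n" by auto
    with dd show False by blast
  qed
  have "2 \<le> n" using assms by (rule prime_ge_2_int)
  from divisor_power_sum_defect[OF this] show ?thesis unfolding E by simp
qed

lemma divisor_power_sum_composite:
  assumes "2 \<le> n" "\<not> prime n"
  shows "divisor_power_sum 3 n < (n\<^sup>2 - n + 1) * divisor_power_sum 1 n"
proof -
  let ?E = "{d. 1 < d \<and> d < n \<and> d dvd n}"
  have finE: "finite ?E" by (rule finite_subset[of _ "{0..n}"]) auto
  have pos: "0 < d * (n\<^sup>2 - n + 1 - d\<^sup>2)" if "d \<in> ?E" for d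
  proof -
    have d: "0 < d" "d \<le> n - 1" using that by auto
    then have "d * d \<le> (n - 1) * (n - 1)" by (intro mult_mono) auto
    also have "\<dots> = n * n - 2 * n + 1" by (simp add: algebra_simps)
    finally have "d\<^sup>2 < n\<^sup>2 - n + 1" using assms unfolding power2_eq_square by linarith
    with d show ?thesis by simp
  qed
  obtain d where d: "0 \<le> d" "d dvd n" "d \<noteq> 1" "d \<noteq> n"
    using assms unfolding prime_int_iff by auto
  then have "d \<noteq> 0" "d \<le> n" using assms by (auto dest: zdvd_imp_le)
  with d have "d \<in> ?E" by simp
  then have "?E \<noteq> {}" by blast
  then have "0 < (\<Sum>d \<in> ?E. d * (n\<^sup>2 - n + 1 - d\<^sup>2))" using finE pos by (intro sum_pos)
  with divisor_power_sum_defect[OF assms(1)] show ?thesis by linarith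
qed

text \<open>Outside the residue class \<open>k\<close> the first term is zero while $E_8$ has vectors of every positive even norm. Inside, the
  difference is 240 times the difference of divisor sums compared above.\<close>

lemma theta_comparison:
  fixes L :: "(real ^ 4) set" and n k :: int
  assumes n: "2 \<le> n" and k: "k = 1 \<or> k = 3"
    and L: "int (r L n) = (if n mod 4 = k then 4 * divisor_power_sum 1 n else 0)"
  shows "if prime n \<and> [n = k] (mod 4)
            then 60 * (n\<^sup>2 - n + 1) * int (r L n) - int (r E8 (2 * n)) = 0
          else if \<not> [n = k] (mod 4)
            then 60 * (n\<^sup>2 - n + 1) * int (r L n) - int (r E8 (2 * n)) < 0
          else 60 * (n\<^sup>2 - n + 1) * int (r L n) - int (r E8 (2 * n)) > 0"
proof (cases "n mod 4 = k")
  case False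
  then have "\<not> [n = k] (mod 4)" using k by (auto simp: cong_def)
  moreover have "0 < r E8 (2 * n)" using n by (simp add: r_E8_pos)
  ultimately show ?thesis using False L by simp
next
  case True
  then have cong: "[n = k] (mod 4)" using k by (auto simp: cong_def)
  have "odd n" using True k by presburger
  then have "int (r E8 (2 * n)) = 240 * divisor_power_sum 3 n" using n by (simp add: r_E8_odd)
  then have diff: "60 * (n\<^sup>2 - n + 1) * int (r L n) - int (r E8 (2 * n))
      = 240 * ((n\<^sup>2 - n + 1) * divisor_power_sum 1 n - divisor_power_sum 3 n)"
    using True L by (simp add: algebra_simps)
  show ?thesis
    unfolding diff using cong divisor_power_sum_prime[of n] divisor_power_sum_composite[OF n] by simp
qed

theorem theorem1p3:
  fixes n :: int
  assumes "n \<ge> 2"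
  shows "(if prime n \<and> [n = 1] (mod 4)
            then 60 * (n\<^sup>2 - n + 1) * int (r L1 n) - int (r E8 (2 * n)) = 0
          else if \<not> [n = 1] (mod 4)
            then 60 * (n\<^sup>2 - n + 1) * int (r L1 n) - int (r E8 (2 * n)) < 0
          else 60 * (n\<^sup>2 - n + 1) * int (r L1 n) - int (r E8 (2 * n)) > 0)
       \<and> (if prime n \<and> [n = 3] (mod 4)
            then 60 * (n\<^sup>2 - n + 1) * int (r L2 n) - int (r E8 (2 * n)) = 0
          else if \<not> [n = 3] (mod 4)
            then 60 * (n\<^sup>2 - n + 1) * int (r L2 n) - int (r E8 (2 * n)) < 0
          else 60 * (n\<^sup>2 - n + 1) * int (r L2 n) - int (r E8 (2 * n)) > 0)"
  using assms theta_comparison[of n 1 L1] theta_comparison[of n 3 L2] by (simp add: r_L1 r_L2)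

end
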